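(* For every $C<1$ there exists $b_0>0$ such that for every $b>b_0$, the mixing time and the relaxation time of the heat-bath Glauber dynamics for proper $k$-colorings of the star graph $G^*$ with $k=Cb/\ln b$ colors are $O(b^{1/C}\ln^2 b)$. When $C=1$ (i.e. $k=b/\ln b$), the mixing and relaxation times are $O(b\ln^4 b)$ (for $b$ sufficiently large).
   Context: $G^*$ is the star graph on $b+1$ vertices: a root $r$ adjacent to $b$ leaves $\ell_1,\dots,\ell_b$ (the complete tree of height 1). A proper $k$-coloring assigns colors from $\{1,\dots,k\}$ so adjacent vertices get distinct colors. The heat-bath Glauber dynamics picks a uniformly random vertex and recolors it uniformly among colors not used by its neighbors. Mixing time: $\min\{t:\max_\sigma\|P^t(\sigma,\cdot)-\pi\|_{TV}\le 1/(2e)\}$ with $\pi$ uniform on proper colorings; relaxation time: $1/(1-\lambda)$ with $\lambda$ the second largest eigenvalue in absolute value of the transition matrix. *)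

theory Defs
  imports "HOL-Analysis.Analysis" "HOL-Library.FuncSet"
begin

definition star_adj :: "nat \<Rightarrow> nat \<Rightarrow> nat \<Rightarrow> bool" where
  "star_adj b u v \<longleftrightarrow> u \<le> b \<and> v \<le> b \<and> ((u = 0 \<and> v \<noteq> 0) \<or> (v = 0 \<and> u \<noteq> 0))"

definition star_colorings :: "nat \<Rightarrow> nat \<Rightarrow> (nat \<Rightarrow> nat) set" where
  "star_colorings b k =
     {\<sigma> \<in> {0..b} \<rightarrow>\<^sub>E {1..k}. \<forall>u v. star_adj b u v \<longrightarrow> \<sigma> u \<noteq> \<sigma> v}"

definition allowed :: "nat \<Rightarrow> nat \<Rightarrow> (nat \<Rightarrow> nat) \<Rightarrow> nat \<Rightarrow> nat set" where
  "allowed b k \<sigma> v = {c \<in> {1..k}. \<forall>u. star_adj b v u \<longrightarrow> \<sigma> u \<noteq> c}"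

definition glauber_P :: "nat \<Rightarrow> nat \<Rightarrow> (nat \<Rightarrow> nat) \<Rightarrow> (nat \<Rightarrow> nat) \<Rightarrow> real" where
  "glauber_P b k \<sigma> \<tau> =
     (1 / real (b + 1)) *
     (\<Sum>v\<in>{0..b}. if (\<forall>u. u \<noteq> v \<longrightarrow> \<sigma> u = \<tau> u) \<and> \<tau> v \<in> allowed b k \<sigma> v
                   then 1 / real (card (allowed b k \<sigma> v)) else 0)"

primrec glauber_Pt :: "nat \<Rightarrow> nat \<Rightarrow> nat \<Rightarrow> (nat \<Rightarrow> nat) \<Rightarrow> (nat \<Rightarrow> nat) \<Rightarrow> real" where
  "glauber_Pt b k 0 \<sigma> \<tau> = (if \<sigma> = \<tau> then 1 else 0)"
| "glauber_Pt b k (Suc t) \<sigma> \<tau> =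
     (\<Sum>\<rho>\<in>star_colorings b k. glauber_Pt b k t \<sigma> \<rho> * glauber_P b k \<rho> \<tau>)"

definition tv_to_uniform :: "nat \<Rightarrow> nat \<Rightarrow> nat \<Rightarrow> (nat \<Rightarrow> nat) \<Rightarrow> real" where
  "tv_to_uniform b k t \<sigma> =
     (1/2) * (\<Sum>\<tau>\<in>star_colorings b k.
                 \<bar>glauber_Pt b k t \<sigma> \<tau> - 1 / real (card (star_colorings b k))\<bar>)"

definition mixing_time :: "nat \<Rightarrow> nat \<Rightarrow> nat" where
  "mixing_time b k =
     (LEAST t. \<forall>\<sigma>\<in>star_colorings b k. tv_to_uniform b k t \<sigma> \<le> 1 / (2 * exp 1))"

text \<open>Eigenvalues of the transition matrix, acting on functions f on the state space,
  whose eigenfunction is orthogonal to the constants (the top eigenvector, since the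
  matrix is symmetric). Taking the largest absolute value over these yields the second
  largest eigenvalue in absolute value (counted with multiplicity).\<close>

definition nontrivial_eigenvalue :: "nat \<Rightarrow> nat \<Rightarrow> real \<Rightarrow> bool" where
  "nontrivial_eigenvalue b k l \<longleftrightarrow>
     (\<exists>f :: (nat \<Rightarrow> nat) \<Rightarrow> real.
        (\<exists>\<sigma>\<in>star_colorings b k. f \<sigma> \<noteq> 0) \<and>
        (\<Sum>\<sigma>\<in>star_colorings b k. f \<sigma>) = 0 \<and>
        (\<forall>\<sigma>\<in>star_colorings b k.
           (\<Sum>\<tau>\<in>star_colorings b k. glauber_P b k \<sigma> \<tau> * f \<tau>) = l * f \<sigma>))"

definition lambda_star :: "nat \<Rightarrow> nat \<Rightarrow> real" where
  "lambda_star b k = Sup {\<bar>l\<bar> | l. nontrivial_eigenvalue b k l}"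

definition relaxation_time :: "nat \<Rightarrow> nat \<Rightarrow> real" where
  "relaxation_time b k = 1 / (1 - lambda_star b k)"

end

theory Submission
  imports Defs "HOL-Real_Asymp.Real_Asymp"
begin

text \<open>
  Mixing is bounded in \<open>L\<^sup>2\<close>. A Poincare inequality gives the gap: Efron--Stein handles the leaves,
  and for functions of the root colour alone the root moves from \<open>r\<close> to \<open>s\<close> exactly when no leaf
  has colour \<open>s\<close>, an event of conditional probability about \<open>exp (- b / k) = b powr (- 1 / C)\<close>;
  this yields a gap of order \<open>1 / (b powr (1 / C) * ln b)\<close>. After about \<open>2 * b * ln b\<close> steps every
  leaf has been resampled, each time with a given colour having probability at most \<open>1 / (k - 1)\<close>
  whatever the past, so the density with respect to the uniform measure is at most \<open>e * k\<close>. Starting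
  the \<open>L\<^sup>2\<close> decay from there costs only a factor \<open>O (ln b)\<close> over the inverse gap.
\<close>

text \<open>The obstacle is the worst-case start. A point mass has density
  \<open>k * (k - 1) ^ b\<close>, whose logarithm has order \<open>b * ln b\<close>; L2 decay from
  there would lose that whole factor. Almost all of it is due to the leaves, which equilibrate
  quickly. The root is the slow part and is never assumed to have moved: it leaves the factor
  \<open>k\<close> in the density, and \<open>ln k\<close> is cheap. The two logarithms in the bound
  have different origins. One is this \<open>ln k\<close>. The other sits in the gap: the root is
  picked with probability \<open>1 / (b + 1)\<close>, each of the \<open>k\<close> colours is open
  to it with probability about \<open>b powr (- 1 / C)\<close>, and \<open>k / b\<close> is about
  \<open>C / ln b\<close>. The hypothesis \<open>few\<close>, carried along below, says that once a
  second colour is free at the root, on average at most one further colour is; hence a free colour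
  is not drowned out by competitors. At \<open>C = 1\<close> nothing changes, and the result,
  \<open>b\<close> times the square of \<open>ln b\<close>, is better than claimed.\<close>

section \<open>Star colourings and recolouring of one vertex\<close>

lemma star_colorings_iff:
  "\<sigma> \<in> star_colorings b k \<longleftrightarrow>
     \<sigma> \<in> {0..b} \<rightarrow>\<^sub>E {1..k} \<and> (\<forall>i\<in>{1..b}. \<sigma> i \<noteq> \<sigma> 0)"
proof
  assume "\<sigma> \<in> star_colorings b k"
  then show "\<sigma> \<in> {0..b} \<rightarrow>\<^sub>E {1..k} \<and> (\<forall>i\<in>{1..b}. \<sigma> i \<noteq> \<sigma> 0)"
    by (auto simp: star_colorings_def star_adj_def)
next
  assume A: "\<sigma> \<in> {0..b} \<rightarrow>\<^sub>E {1..k} \<and> (\<forall>i\<in>{1..b}. \<sigma> i \<noteq> \<sigma> 0)"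
  have "\<sigma> u \<noteq> \<sigma> v" if "star_adj b u v" for u v
  proof (cases "u = 0")
    case True
    then have "v \<in> {1..b}" using that by (auto simp: star_adj_def)
    then show ?thesis using A True by fastforce
  next
    case False
    then have "u \<in> {1..b}" "v = 0" using that by (auto simp: star_adj_def)
    then show ?thesis using A by fastforce
  qed
  then show "\<sigma> \<in> star_colorings b k"
    using A by (auto simp: star_colorings_def)
qed

lemma allowed_leaf:
  assumes "v \<in> {1..b}"
  shows "allowed b k \<sigma> v = {1..k} - {\<sigma> 0}"
  using assms by (auto simp: allowed_def star_adj_def)

lemma allowed_root: "allowed b k \<sigma> 0 = {1..k} - \<sigma> ` {1..b}"
  by (auto simp: allowed_def star_adj_def)

lemma allowed_upd [simp]: "allowed b k (\<sigma>(v := c)) v = allowed b k \<sigma> v"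
proof -
  have "\<not> star_adj b v v" by (auto simp: star_adj_def)
  then show ?thesis by (auto simp: allowed_def)
qed

lemma finite_allowed [simp]: "finite (allowed b k \<sigma> v)"
  by (simp add: allowed_def)

lemma finite_star_colorings [simp]: "finite (star_colorings b k)"
  by (rule finite_subset[of _ "{0..b} \<rightarrow>\<^sub>E {1..k}"])
     (auto simp: star_colorings_def intro: finite_PiE)

lemma star_colorings_upd:
  assumes s: "\<sigma> \<in> star_colorings b k" and v: "v \<le> b" and c: "c \<in> allowed b k \<sigma> v"
  shows "\<sigma>(v := c) \<in> star_colorings b k"
proof -
  have p: "\<sigma> \<in> {0..b} \<rightarrow>\<^sub>E {1..k}" and l: "\<forall>i\<in>{1..b}. \<sigma> i \<noteq> \<sigma> 0"
    using s by (auto simp: star_colorings_iff)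
  have "c \<in> {1..k}" using c by (simp add: allowed_def)
  then have "\<sigma>(v := c) \<in> {0..b} \<rightarrow>\<^sub>E {1..k}"
    using p v by (auto simp: PiE_iff extensional_def)
  moreover have "\<forall>i\<in>{1..b}. (\<sigma>(v := c)) i \<noteq> (\<sigma>(v := c)) 0"
  proof (cases "v = 0")
    case True
    then show ?thesis using c by (auto simp: allowed_root)
  next
    case False
    then show ?thesis using c v l by (auto simp: allowed_leaf)
  qed
  ultimately show ?thesis by (simp add: star_colorings_iff)
qed

lemma self_allowed:
  assumes s: "\<sigma> \<in> star_colorings b k" and v: "v \<le> b"
  shows "\<sigma> v \<in> allowed b k \<sigma> v"
proof -
  have "\<sigma> v \<in> {1..k}" using s v by (auto simp: star_colorings_def)
  moreover have "\<forall>u. star_adj b v u \<longrightarrow> \<sigma> u \<noteq> \<sigma> v"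
    using s by (force simp: star_colorings_def)
  ultimately show ?thesis by (simp add: allowed_def)
qed

lemma card_allowed_pos:
  assumes "\<sigma> \<in> star_colorings b k" "v \<le> b"
  shows "0 < card (allowed b k \<sigma> v)"
  using self_allowed[OF assms] by (auto simp: card_gt_0_iff)

section \<open>Resampling as an orthogonal projection, and its Dirichlet form\<close>

text \<open>The conditional expectation of \<open>f\<close> under the uniform measure, given all
  colours except that of \<open>v\<close>.\<close>

definition resample :: "nat \<Rightarrow> nat \<Rightarrow> nat \<Rightarrow> ((nat \<Rightarrow> nat) \<Rightarrow> real) \<Rightarrow> (nat \<Rightarrow> nat) \<Rightarrow> real" where
  "resample b k v f \<sigma> =
     (\<Sum>c\<in>allowed b k \<sigma> v. f (\<sigma>(v := c))) / real (card (allowed b k \<sigma> v))"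

lemma resample_upd [simp]: "resample b k v f (\<sigma>(v := c)) = resample b k v f \<sigma>"
  by (simp add: resample_def)

lemma resample_const:
  assumes "\<sigma> \<in> star_colorings b k" "v \<le> b"
    and "\<And>c. c \<in> allowed b k \<sigma> v \<Longrightarrow> f (\<sigma>(v := c)) = a"
  shows "resample b k v f \<sigma> = a"
  using card_allowed_pos[OF assms(1,2)] assms(3) by (auto simp: resample_def)

lemma resample_idem:
  assumes "\<sigma> \<in> star_colorings b k" "v \<le> b"
  shows "resample b k v (resample b k v f) \<sigma> = resample b k v f \<sigma>"
  by (rule resample_const[OF assms]) (rule resample_upd)

lemma resample_diff:
  "resample b k v (\<lambda>\<sigma>. f \<sigma> - g \<sigma>) \<sigma> = resample b k v f \<sigma> - resample b k v g \<sigma>"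
  by (simp add: resample_def sum_subtractf diff_divide_distrib)

text \<open>Reversibility of one update: recolouring \<open>v\<close> does not change
  \<open>allowed\<close> at \<open>v\<close>, so exchanging the old and the new colour is an
  involution on the pairs summed over.\<close>

lemma sum_swap_vertex:
  fixes \<phi> :: "(nat \<Rightarrow> nat) \<Rightarrow> (nat \<Rightarrow> nat) \<Rightarrow> real"
  assumes v: "v \<le> b"
  shows "(\<Sum>\<sigma>\<in>star_colorings b k. \<Sum>c\<in>allowed b k \<sigma> v. \<phi> \<sigma> (\<sigma>(v := c))) =
         (\<Sum>\<sigma>\<in>star_colorings b k. \<Sum>c\<in>allowed b k \<sigma> v. \<phi> (\<sigma>(v := c)) \<sigma>)"
proof -
  let ?S = "SIGMA \<sigma>:star_colorings b k. allowed b k \<sigma> v"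
  have "(\<Sum>(\<sigma>, c)\<in>?S. \<phi> \<sigma> (\<sigma>(v := c))) = (\<Sum>(\<sigma>, c)\<in>?S. \<phi> (\<sigma>(v := c)) \<sigma>)"
    by (rule sum.reindex_bij_witness[where i = "\<lambda>(\<sigma>, c). (\<sigma>(v := c), \<sigma> v)"
            and j = "\<lambda>(\<sigma>, c). (\<sigma>(v := c), \<sigma> v)"])
       (use v in \<open>auto intro: star_colorings_upd self_allowed\<close>)
  then show ?thesis by (simp add: sum.Sigma)
qed

lemma resample_self_adjoint:
  assumes v: "v \<le> b"
  shows "(\<Sum>\<sigma>\<in>star_colorings b k. f \<sigma> * resample b k v g \<sigma>) =
         (\<Sum>\<sigma>\<in>star_colorings b k. resample b k v f \<sigma> * g \<sigma>)"
  using sum_swap_vertex[OF v, where k = k and \<phi> = "\<lambda>\<sigma> \<tau>. f \<sigma> * g \<tau> / real (card (allowed b k \<sigma> v))"]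
  by (simp add: resample_def sum_distrib_left sum_distrib_right sum_divide_distrib mult.commute)

lemma sum_resample:
  assumes v: "v \<le> b"
  shows "(\<Sum>\<sigma>\<in>star_colorings b k. resample b k v f \<sigma>) = (\<Sum>\<sigma>\<in>star_colorings b k. f \<sigma>)"
proof -
  have "resample b k v (\<lambda>_. 1) \<sigma> = 1" if "\<sigma> \<in> star_colorings b k" for \<sigma>
    using that v by (intro resample_const) simp_all
  then show ?thesis
    using resample_self_adjoint[OF v, where k = k and f = "\<lambda>_. 1" and g = f] by simp
qed

lemma sum_resample_sq:
  assumes v: "v \<le> b"
  shows "(\<Sum>\<sigma>\<in>star_colorings b k. (resample b k v f \<sigma>)\<^sup>2) =
         (\<Sum>\<sigma>\<in>star_colorings b k. f \<sigma> * resample b k v f \<sigma>)"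
  using resample_self_adjoint[OF v, where k = k and f = f and g = "resample b k v f"] v
  by (simp add: resample_idem power2_eq_square)

text \<open>The Dirichlet form of the update at \<open>v\<close>, left unnormalised: neither the
  number of colourings nor \<open>b + 1\<close> is divided out.\<close>

definition local_form :: "nat \<Rightarrow> nat \<Rightarrow> nat \<Rightarrow> ((nat \<Rightarrow> nat) \<Rightarrow> real) \<Rightarrow> real" where
  "local_form b k v f = (\<Sum>\<sigma>\<in>star_colorings b k. f \<sigma> * (f \<sigma> - resample b k v f \<sigma>))"

lemma local_form_eq_sq:
  assumes v: "v \<le> b"
  shows "local_form b k v f = (\<Sum>\<sigma>\<in>star_colorings b k. (f \<sigma> - resample b k v f \<sigma>)\<^sup>2)"
proof -
  have "(f \<sigma> - resample b k v f \<sigma>)\<^sup>2 =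
      f \<sigma> * (f \<sigma> - resample b k v f \<sigma>) + ((resample b k v f \<sigma>)\<^sup>2 - f \<sigma> * resample b k v f \<sigma>)" for \<sigma>
    by (simp add: algebra_simps power2_eq_square)
  then show ?thesis
    by (simp add: local_form_def sum.distrib sum_subtractf sum_resample_sq[OF v])
qed

lemma local_form_nonneg: "v \<le> b \<Longrightarrow> 0 \<le> local_form b k v f"
  by (simp add: local_form_eq_sq sum_nonneg)

lemma resample_contract:
  assumes v: "v \<le> b"
  shows "(\<Sum>\<sigma>\<in>star_colorings b k. (resample b k v f \<sigma>)\<^sup>2) \<le> (\<Sum>\<sigma>\<in>star_colorings b k. (f \<sigma>)\<^sup>2)"
  using sum_resample_sq[OF v, where k = k and f = f] local_form_nonneg[OF v, where k = k and f = f]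
  by (simp add: local_form_def right_diff_distrib sum_subtractf power2_eq_square)

lemma local_form_le_sq:
  assumes v: "v \<le> b"
  shows "local_form b k v f \<le> (\<Sum>\<sigma>\<in>star_colorings b k. (f \<sigma>)\<^sup>2)"
proof -
  have "0 \<le> (\<Sum>\<sigma>\<in>star_colorings b k. f \<sigma> * resample b k v f \<sigma>)"
    unfolding sum_resample_sq[OF v, symmetric] by (simp add: sum_nonneg)
  then show ?thesis
    by (simp add: local_form_def right_diff_distrib sum_subtractf power2_eq_square)
qed

lemma local_form_diff_le:
  assumes v: "v \<le> b"
  shows "local_form b k v (\<lambda>\<sigma>. f \<sigma> - h \<sigma>) \<le> 2 * local_form b k v f + 2 * local_form b k v h"
proof -
  have "(x - y)\<^sup>2 \<le> 2 * x\<^sup>2 + 2 * y\<^sup>2" for x y :: real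
    using zero_le_power2[of "x + y"] by (simp add: power2_sum power2_diff)
  then have "(f \<sigma> - h \<sigma> - (resample b k v f \<sigma> - resample b k v h \<sigma>))\<^sup>2 \<le>
        2 * (f \<sigma> - resample b k v f \<sigma>)\<^sup>2 + 2 * (h \<sigma> - resample b k v h \<sigma>)\<^sup>2" for \<sigma>
    by (metis diff_diff_eq add.commute diff_diff_eq2 diff_add_eq)
  then show ?thesis
    by (simp add: local_form_eq_sq[OF v] resample_diff sum_distrib_left
          sum.distrib[symmetric] sum_mono)
qed

text \<open>After expanding the square, both diagonal terms equal the squared norm of
  \<open>f\<close>, the second by reversibility. At the root this form exposes a weight for each
  pair of root colours.\<close>

lemma local_form_eq_jumps:
  assumes v: "v \<le> b"
  shows "2 * local_form b k v f =
    (\<Sum>\<sigma>\<in>star_colorings b k. \<Sum>c\<in>allowed b k \<sigma> v.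
        (f \<sigma> - f (\<sigma>(v := c)))\<^sup>2 / real (card (allowed b k \<sigma> v)))"
proof -
  let ?n = "\<lambda>\<sigma>. real (card (allowed b k \<sigma> v))"
  have sq: "(\<Sum>\<sigma>\<in>star_colorings b k. \<Sum>c\<in>allowed b k \<sigma> v. (f \<sigma>)\<^sup>2 / ?n \<sigma>) =
        (\<Sum>\<sigma>\<in>star_colorings b k. (f \<sigma>)\<^sup>2)"
    by (intro sum.cong refl) (use card_allowed_pos[OF _ v] in force)
  have sq': "(\<Sum>\<sigma>\<in>star_colorings b k. \<Sum>c\<in>allowed b k \<sigma> v. (f (\<sigma>(v := c)))\<^sup>2 / ?n \<sigma>) =
        (\<Sum>\<sigma>\<in>star_colorings b k. (f \<sigma>)\<^sup>2)"
    using sum_swap_vertex[OF v, where k = k and \<phi> = "\<lambda>\<sigma> \<tau>. (f \<sigma>)\<^sup>2 / ?n \<sigma>"] sq by simp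
  have "(\<Sum>\<sigma>\<in>star_colorings b k. \<Sum>c\<in>allowed b k \<sigma> v. (f \<sigma> - f (\<sigma>(v := c)))\<^sup>2 / ?n \<sigma>) =
     (\<Sum>\<sigma>\<in>star_colorings b k. \<Sum>c\<in>allowed b k \<sigma> v. (f \<sigma>)\<^sup>2 / ?n \<sigma>) +
     (\<Sum>\<sigma>\<in>star_colorings b k. \<Sum>c\<in>allowed b k \<sigma> v. (f (\<sigma>(v := c)))\<^sup>2 / ?n \<sigma>) -
     2 * (\<Sum>\<sigma>\<in>star_colorings b k. f \<sigma> * resample b k v f \<sigma>)"
    by (simp add: resample_def power2_diff sum.distrib[symmetric] sum_subtractf[symmetric]
          sum_distrib_left sum_divide_distrib diff_divide_distrib add_divide_distrib mult.assoc
          del: sum_constant)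
  then show ?thesis
    unfolding sq sq'
    by (simp add: local_form_def right_diff_distrib sum_subtractf power2_eq_square)
qed

section \<open>Averaging out the leaves\<close>

text \<open>Given the root the leaves are independent, so the full sweep is the conditional
  expectation given the root colour. Building it leaf by leaf makes the variance bound an
  induction.\<close>

primrec sweep :: "nat \<Rightarrow> nat \<Rightarrow> nat \<Rightarrow> ((nat \<Rightarrow> nat) \<Rightarrow> real) \<Rightarrow> (nat \<Rightarrow> nat) \<Rightarrow> real" where
  "sweep b k 0 f = f"
| "sweep b k (Suc n) f = resample b k (Suc n) (sweep b k n f)"

lemma sum_sweep:
  "n \<le> b \<Longrightarrow> (\<Sum>\<sigma>\<in>star_colorings b k. sweep b k n f \<sigma>) = (\<Sum>\<sigma>\<in>star_colorings b k. f \<sigma>)"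
  by (induction n) (simp_all add: sum_resample)

text \<open>Efron--Stein inequality: the increment splits into the orthogonal pieces
  \<open>f - E f\<close> and \<open>E (f - g)\<close>, where \<open>E\<close> is the projection for the next vertex.\<close>

lemma sweep_variance_le:
  "n \<le> b \<Longrightarrow> (\<Sum>\<sigma>\<in>star_colorings b k. (f \<sigma> - sweep b k n f \<sigma>)\<^sup>2) \<le>
     (\<Sum>i\<in>{1..n}. local_form b k i f)"
proof (induction n)
  case 0
  then show ?case by simp
next
  case (Suc n)
  let ?g = "sweep b k n f"
  let ?E = "resample b k (Suc n)"
  let ?h = "\<lambda>\<sigma>. f \<sigma> - ?g \<sigma>"
  let ?d = "\<lambda>\<sigma>. f \<sigma> - ?E f \<sigma>"
  note v = Suc.prems
  have "(\<Sum>\<sigma>\<in>star_colorings b k. ?d \<sigma> * ?E ?h \<sigma>) = (\<Sum>\<sigma>\<in>star_colorings b k. ?E ?d \<sigma> * ?h \<sigma>)"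
    by (rule resample_self_adjoint[OF v])
  also have "\<dots> = 0"
    by (rule sum.neutral) (simp add: resample_diff[of b k _ f] resample_idem[OF _ v])
  finally have cross: "(\<Sum>\<sigma>\<in>star_colorings b k. ?d \<sigma> * ?E ?h \<sigma>) = 0" .
  have "(f \<sigma> - ?E ?g \<sigma>)\<^sup>2 = (?d \<sigma>)\<^sup>2 + (?E ?h \<sigma>)\<^sup>2 + 2 * (?d \<sigma> * ?E ?h \<sigma>)" for \<sigma>
    by (simp add: resample_diff power2_eq_square algebra_simps)
  then have "(\<Sum>\<sigma>\<in>star_colorings b k. (f \<sigma> - ?E ?g \<sigma>)\<^sup>2) =
      local_form b k (Suc n) f + (\<Sum>\<sigma>\<in>star_colorings b k. (?E ?h \<sigma>)\<^sup>2)"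
    by (simp add: sum.distrib sum_distrib_left[symmetric] cross local_form_eq_sq[OF v])
  also have "\<dots> \<le> local_form b k (Suc n) f + (\<Sum>\<sigma>\<in>star_colorings b k. (?h \<sigma>)\<^sup>2)"
    using resample_contract[OF v, where f = ?h and k = k] by simp
  also have "\<dots> \<le> (\<Sum>i\<in>{1..Suc n}. local_form b k i f)"
    using Suc by simp
  finally show ?case by simp
qed

text \<open>A leaf that has been averaged out stays invisible, because updates at distinct leaves
  commute: the colours allowed at a leaf depend on the root only.\<close>

lemma sweep_upd:
  "\<lbrakk>n \<le> b; 1 \<le> i; i \<le> n; \<sigma> \<in> star_colorings b k; c \<in> allowed b k \<sigma> i\<rbrakk>
     \<Longrightarrow> sweep b k n f (\<sigma>(i := c)) = sweep b k n f \<sigma>"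
proof (induction n arbitrary: \<sigma>)
  case 0
  then show ?case by simp
next
  case (Suc n)
  show ?case
  proof (cases "i = Suc n")
    case True
    show ?thesis unfolding True sweep.simps by (rule resample_upd)
  next
    case False
    have a: "allowed b k (\<sigma>(i := c)) (Suc n) = allowed b k \<sigma> (Suc n)"
      using Suc.prems by (simp add: allowed_leaf)
    have "sweep b k n f (\<sigma>(i := c, Suc n := d)) = sweep b k n f (\<sigma>(Suc n := d))"
      if d: "d \<in> allowed b k \<sigma> (Suc n)" for d
    proof -
      have "\<sigma>(Suc n := d) \<in> star_colorings b k"
        using star_colorings_upd Suc.prems d by blast
      moreover have "c \<in> allowed b k (\<sigma>(Suc n := d)) i"
        using Suc.prems by (simp add: allowed_leaf)
      ultimately have "sweep b k n f (\<sigma>(Suc n := d, i := c)) = sweep b k n f (\<sigma>(Suc n := d))"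
        using Suc.IH[of "\<sigma>(Suc n := d)"] Suc.prems(1-3) False by linarith
      then show ?thesis unfolding fun_upd_twist[OF False] .
    qed
    then have "(\<Sum>d\<in>allowed b k \<sigma> (Suc n). sweep b k n f (\<sigma>(i := c, Suc n := d))) =
        (\<Sum>d\<in>allowed b k \<sigma> (Suc n). sweep b k n f (\<sigma>(Suc n := d)))"
      by (rule sum.cong[OF refl])
    then show ?thesis unfolding sweep.simps resample_def a by (simp only:)
  qed
qed

text \<open>Replace the leaves of \<open>\<sigma>\<close> by those of \<open>\<tau>\<close> one at a
  time. The common root colour keeps every intermediate \<open>\<rho> n\<close> proper, and no
  replacement is seen by the sweep.\<close>

lemma sweep_root:
  assumes s: "\<sigma> \<in> star_colorings b k" and t: "\<tau> \<in> star_colorings b k" and e: "\<sigma> 0 = \<tau> 0"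
  shows "sweep b k b f \<sigma> = sweep b k b f \<tau>"
proof -
  define \<rho> where "\<rho> n i = (if 1 \<le> i \<and> i \<le> n then \<tau> i else \<sigma> i)" for n i :: nat
  have "n \<le> b \<Longrightarrow> \<rho> n \<in> star_colorings b k \<and> sweep b k b f (\<rho> n) = sweep b k b f \<sigma>" for n
  proof (induction n)
    case 0
    have "\<rho> 0 = \<sigma>" by (auto simp: \<rho>_def fun_eq_iff)
    then show ?case using s by simp
  next
    case (Suc n)
    have r: "\<rho> (Suc n) = (\<rho> n)(Suc n := \<tau> (Suc n))" by (auto simp: \<rho>_def fun_eq_iff)
    have "\<tau> (Suc n) \<in> allowed b k \<tau> (Suc n)" using self_allowed[OF t] Suc.prems by simp
    then have "\<tau> (Suc n) \<in> allowed b k (\<rho> n) (Suc n)"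
      using Suc.prems e by (simp add: allowed_leaf \<rho>_def)
    moreover have "\<rho> n \<in> star_colorings b k" "sweep b k b f (\<rho> n) = sweep b k b f \<sigma>"
      using Suc by auto
    ultimately show ?case
      unfolding r using star_colorings_upd[OF _ Suc.prems]
        sweep_upd[OF order.refl _ Suc.prems, of "\<rho> n" k "\<tau> (Suc n)" f]
      by (metis One_nat_def Suc_le_mono le0)
  qed
  moreover have "\<rho> b = \<tau>"
  proof
    fix i
    \<comment> \<open>Beyond \<open>b\<close> both colourings take the extensional default value, so
      agreement on the star is equality of functions.\<close>
    have "\<sigma> i = undefined" "\<tau> i = undefined" if "i > b"
      using that s t by (auto simp: star_colorings_iff PiE_iff extensional_def)
    then show "\<rho> b i = \<tau> i"
      using e by (cases "i = 0"; cases "i > b") (auto simp: \<rho>_def)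
  qed
  ultimately show ?thesis by force
qed

section \<open>The root: counting free colours and a Poincare inequality\<close>

text \<open>With the root colour in \<open>B\<close>, properness is automatic and the set is a
  product. Sizes 1, 2 and 3 of \<open>B\<close> give every count needed for the root.\<close>

lemma card_avoiding:
  assumes r: "r \<in> B" and B: "B \<subseteq> {1..k}"
  shows "card {\<sigma> \<in> star_colorings b k. \<sigma> 0 = r \<and> (\<forall>i\<in>{1..b}. \<sigma> i \<notin> B)} = (k - card B) ^ b"
proof -
  have "{\<sigma> \<in> star_colorings b k. \<sigma> 0 = r \<and> (\<forall>i\<in>{1..b}. \<sigma> i \<notin> B)} =
      PiE {0..b} (\<lambda>i. if i = 0 then {r} else {1..k} - B)" (is "?L = ?R")
  proof (intro equalityI subsetI)
    fix \<sigma> assume "\<sigma> \<in> ?L"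
    then show "\<sigma> \<in> ?R" by (auto simp: star_colorings_iff PiE_iff)
  next
    fix \<sigma> assume s: "\<sigma> \<in> ?R"
    have 0: "\<sigma> 0 = r" using PiE_mem[OF s, of 0] by simp
    have leaf: "\<sigma> i \<in> {1..k} - B" if "i \<in> {1..b}" for i
      using PiE_mem[OF s, of i] that by simp
    have "\<sigma> i \<in> {1..k}" if "i \<in> {0..b}" for i
      using leaf[of i] 0 r B that by (cases "i = 0") auto
    then have "\<sigma> \<in> {0..b} \<rightarrow>\<^sub>E {1..k}" using s by (auto simp: PiE_iff)
    moreover have "\<forall>i\<in>{1..b}. \<sigma> i \<noteq> \<sigma> 0" using leaf 0 r by force
    ultimately show "\<sigma> \<in> ?L" using 0 leaf by (simp add: star_colorings_iff)
  qed
  moreover have "{0..b} = insert 0 {1..b}" by auto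
  moreover have "card ({1..k} - B) = k - card B"
    using B by (simp add: card_Diff_subset finite_subset)
  ultimately show ?thesis by (simp add: card_PiE)
qed

lemma avoiding_iff:
  assumes "s \<in> {1..k}"
  shows "\<sigma> \<in> star_colorings b k \<and> \<sigma> 0 = r \<and> s \<in> allowed b k \<sigma> 0 \<longleftrightarrow>
    \<sigma> \<in> star_colorings b k \<and> \<sigma> 0 = r \<and> (\<forall>i\<in>{1..b}. \<sigma> i \<notin> {r, s})"
  using assms by (auto simp: star_colorings_iff allowed_root)

lemma sum_by_root:
  "(\<Sum>\<sigma>\<in>star_colorings b k. F \<sigma>) =
     (\<Sum>r\<in>{1..k}. \<Sum>\<sigma>\<in>{\<sigma> \<in> star_colorings b k. \<sigma> 0 = r}. (F \<sigma> :: real))"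
  by (rule sum.group[symmetric]) (auto simp: star_colorings_iff PiE_iff)

lemma card_root:
  assumes "r \<in> {1..k}"
  shows "card {\<sigma> \<in> star_colorings b k. \<sigma> 0 = r} = (k - 1) ^ b"
proof -
  have "{\<sigma> \<in> star_colorings b k. \<sigma> 0 = r} =
      {\<sigma> \<in> star_colorings b k. \<sigma> 0 = r \<and> (\<forall>i\<in>{1..b}. \<sigma> i \<notin> {r})}"
    by (auto simp: star_colorings_iff)
  then show ?thesis using card_avoiding[of r "{r}" k b] assms by simp
qed

lemma card_star_colorings: "card (star_colorings b k) = k * (k - 1) ^ b"
proof -
  have "real (card (star_colorings b k)) = real (k * (k - 1) ^ b)"
    using sum_by_root[of "\<lambda>_. 1" b k] by (simp add: card_root del: of_nat_diff)
  then show ?thesis by linarith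
qed

text \<open>The average number of colours available at the root, given that \<open>s\<close> is available, is
  at most 3; the bound \<open>1 / a \<ge> (6 - a) / 9\<close> is the tangent line at 3.\<close>

lemma flip_weight_ge:
  assumes r: "r \<in> {1..k}" and s: "s \<in> {1..k}" and rs: "r \<noteq> s"
    and few: "(k - 2) * (k - 3) ^ b \<le> (k - 2) ^ b"
  shows "real ((k - 2) ^ b) / 3 \<le>
    (\<Sum>\<sigma>\<in>{\<sigma> \<in> star_colorings b k. \<sigma> 0 = r \<and> s \<in> allowed b k \<sigma> 0}.
        1 / real (card (allowed b k \<sigma> 0)))"
proof -
  let ?S = "{\<sigma> \<in> star_colorings b k. \<sigma> 0 = r \<and> s \<in> allowed b k \<sigma> 0}"
  let ?n = "(k - 2) ^ b"
  have S: "?S = {\<sigma> \<in> star_colorings b k. \<sigma> 0 = r \<and> (\<forall>i\<in>{1..b}. \<sigma> i \<notin> {r, s})}"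
    using avoiding_iff[OF s] by blast
  have cS: "card ?S = ?n"
    unfolding S using card_avoiding[of r "{r, s}" k b] r s rs by (simp add: numeral_2_eq_2)
  have fS: "finite ?S" by simp
  have u: "card {\<sigma> \<in> ?S. u \<in> allowed b k \<sigma> 0} = (k - 3) ^ b"
    if "u \<in> {1..k} - {r, s}" for u
  proof -
    have "{\<sigma> \<in> ?S. u \<in> allowed b k \<sigma> 0} =
        {\<sigma> \<in> star_colorings b k. \<sigma> 0 = r \<and> (\<forall>i\<in>{1..b}. \<sigma> i \<notin> {r, s, u})}"
      unfolding S using that by (auto simp: allowed_root)
    moreover have "card {r, s, u} = 3" using that rs by auto
    ultimately show ?thesis using card_avoiding[of r "{r, s, u}" k b] that r s by simp
  qed
  have "(\<Sum>\<sigma>\<in>?S. card (allowed b k \<sigma> 0)) =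
      (\<Sum>\<sigma>\<in>?S. \<Sum>u\<in>{1..k}. if u \<in> allowed b k \<sigma> 0 then 1 else 0)"
  proof (rule sum.cong[OF refl])
    fix \<sigma>
    have "{1..k} \<inter> {u. u \<in> allowed b k \<sigma> 0} = allowed b k \<sigma> 0" by (auto simp: allowed_def)
    then show "card (allowed b k \<sigma> 0) = (\<Sum>u\<in>{1..k}. if u \<in> allowed b k \<sigma> 0 then 1 else 0)"
      by (simp add: sum.If_cases)
  qed
  also have "\<dots> = (\<Sum>u\<in>{1..k}. \<Sum>\<sigma>\<in>?S. if u \<in> allowed b k \<sigma> 0 then 1 else 0)"
    by (rule sum.swap)
  also have "\<dots> = (\<Sum>u\<in>{1..k}. card {\<sigma> \<in> ?S. u \<in> allowed b k \<sigma> 0})"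
    using fS by (simp add: sum.If_cases Int_def)
  \<comment> \<open>The colours \<open>r\<close> and \<open>s\<close> add at most 2 to the average;
    by \<open>few\<close> all the others together add at most 1.\<close>
  also have "\<dots> = (\<Sum>u\<in>{1..k} - {r, s}. card {\<sigma> \<in> ?S. u \<in> allowed b k \<sigma> 0}) +
      (\<Sum>u\<in>{r, s}. card {\<sigma> \<in> ?S. u \<in> allowed b k \<sigma> 0})"
    using r s by (intro sum.subset_diff) auto
  also have "\<dots> \<le> (k - 2) * (k - 3) ^ b + 2 * ?n"
  proof -
    have "(\<Sum>u\<in>{1..k} - {r, s}. card {\<sigma> \<in> ?S. u \<in> allowed b k \<sigma> 0}) =
        card ({1..k} - {r, s}) * (k - 3) ^ b"
      using u by simp
    also have "card ({1..k} - {r, s}) = k - 2"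
      using r s rs by (simp add: card_Diff_subset)
    finally have 1: "(\<Sum>u\<in>{1..k} - {r, s}. card {\<sigma> \<in> ?S. u \<in> allowed b k \<sigma> 0}) =
      (k - 2) * (k - 3) ^ b" .
    have "card {\<sigma> \<in> ?S. u \<in> allowed b k \<sigma> 0} \<le> ?n" for u
      unfolding cS[symmetric] by (rule card_mono[OF fS]) auto
    then have "(\<Sum>u\<in>{r, s}. card {\<sigma> \<in> ?S. u \<in> allowed b k \<sigma> 0}) \<le> (\<Sum>u\<in>{r, s}. ?n)"
      by (rule sum_mono)
    then have "(\<Sum>u\<in>{r, s}. card {\<sigma> \<in> ?S. u \<in> allowed b k \<sigma> 0}) \<le> 2 * ?n"
      using rs by simp
    then show ?thesis using 1 by linarith
  qed
  finally have "(\<Sum>\<sigma>\<in>?S. card (allowed b k \<sigma> 0)) \<le> 3 * ?n"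
    using few by linarith
  then have "real (\<Sum>\<sigma>\<in>?S. card (allowed b k \<sigma> 0)) \<le> real (3 * ?n)"
    by (rule of_nat_mono)
  then have A: "(\<Sum>\<sigma>\<in>?S. real (card (allowed b k \<sigma> 0))) \<le> 3 * real ?n"
    unfolding of_nat_sum of_nat_mult by simp
  have "(\<Sum>\<sigma>\<in>?S. (6 - real (card (allowed b k \<sigma> 0))) / 9) \<le>
      (\<Sum>\<sigma>\<in>?S. 1 / real (card (allowed b k \<sigma> 0)))"
  proof (rule sum_mono)
    fix \<sigma> assume "\<sigma> \<in> ?S"
    then have "0 < real (card (allowed b k \<sigma> 0))" using card_allowed_pos[of \<sigma> b k 0] by simp
    moreover have "(6 - a) / 9 \<le> 1 / a" if "0 < a" for a :: real
      using that zero_le_power2[of "a - 3"] by (simp add: field_simps power2_eq_square)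
    ultimately show "(6 - real (card (allowed b k \<sigma> 0))) / 9 \<le> 1 / real (card (allowed b k \<sigma> 0))"
      by blast
  qed
  moreover have "(\<Sum>\<sigma>\<in>?S. (6 - real (card (allowed b k \<sigma> 0))) / 9) =
      (6 * real ?n - (\<Sum>\<sigma>\<in>?S. real (card (allowed b k \<sigma> 0)))) / 9"
    by (simp add: sum_divide_distrib[symmetric] sum_subtractf cS del: of_nat_power)
  moreover have "N / 3 \<le> X" if "Y \<le> X" "Y = (6 * N - Z) / 9" "Z \<le> 3 * N" for N X Y Z :: real
    using that by simp
  ultimately show ?thesis using A by blast
qed

lemma sum_pairs_sq_diff:
  fixes g :: "'a \<Rightarrow> real"
  shows "(\<Sum>r\<in>A. \<Sum>s\<in>A. (g r - g s)\<^sup>2) = 2 * card A * (\<Sum>r\<in>A. (g r)\<^sup>2) - 2 * (\<Sum>r\<in>A. g r)\<^sup>2"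
proof -
  have "(\<Sum>r\<in>A. \<Sum>s\<in>A. (g r - g s)\<^sup>2) =
      (\<Sum>r\<in>A. card A * (g r)\<^sup>2 + (\<Sum>s\<in>A. (g s)\<^sup>2) - 2 * (g r * (\<Sum>s\<in>A. g s)))"
    by (simp add: power2_diff sum.distrib sum_subtractf sum_distrib_left mult.assoc)
  also have "\<dots> = 2 * card A * (\<Sum>r\<in>A. (g r)\<^sup>2) - 2 * (\<Sum>r\<in>A. g r)\<^sup>2"
    by (simp add: sum.distrib sum_subtractf sum_distrib_left[symmetric] sum_distrib_right[symmetric]
          power2_eq_square)
  finally show ?thesis .
qed

text \<open>The root colour moves as on a weighted complete graph: every pair has weight at least
  \<open>(k - 2) ^ b / 3\<close>, and for mean zero the squared differences over all ordered pairs
  sum to \<open>2 * k\<close> times the squared norm. This \<open>k\<close> is what puts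
  \<open>1 / k\<close> into \<open>poincare_const\<close>.\<close>

lemma root_poincare:
  assumes few: "(k - 2) * (k - 3) ^ b \<le> (k - 2) ^ b"
    and k: "k \<ge> 2"
    and G: "\<And>\<sigma>. \<sigma> \<in> star_colorings b k \<Longrightarrow> G \<sigma> = g (\<sigma> 0)"
    and mean: "(\<Sum>\<sigma>\<in>star_colorings b k. G \<sigma>) = 0"
  shows "real k * (real (k - 2)) ^ b * (\<Sum>\<sigma>\<in>star_colorings b k. (G \<sigma>)\<^sup>2) \<le>
     3 * (real (k - 1)) ^ b * local_form b k 0 G"
proof -
  let ?m = "real (k - 1) ^ b" and ?n = "real (k - 2) ^ b"
  let ?w = "\<lambda>r s. \<Sum>\<sigma>\<in>{\<sigma> \<in> star_colorings b k. \<sigma> 0 = r \<and> s \<in> allowed b k \<sigma> 0}.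
        1 / real (card (allowed b k \<sigma> 0))"
  have by_root: "(\<Sum>\<sigma>\<in>star_colorings b k. h (G \<sigma>)) = ?m * (\<Sum>r\<in>{1..k}. h (g r))"
    for h :: "real \<Rightarrow> real"
  proof -
    have "(\<Sum>\<sigma>\<in>star_colorings b k. h (G \<sigma>)) =
        (\<Sum>r\<in>{1..k}. \<Sum>\<sigma>\<in>{\<sigma> \<in> star_colorings b k. \<sigma> 0 = r}. h (g r))"
      unfolding sum_by_root using G by (intro sum.cong) auto
    then show ?thesis by (simp add: card_root sum_distrib_left)
  qed
  have g0: "(\<Sum>r\<in>{1..k}. g r) = 0"
    using by_root[of "\<lambda>x. x"] mean k by simp
  have "2 * local_form b k 0 G =
      (\<Sum>\<sigma>\<in>star_colorings b k. \<Sum>s\<in>allowed b k \<sigma> 0.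
        (g (\<sigma> 0) - g s)\<^sup>2 / real (card (allowed b k \<sigma> 0)))"
    unfolding local_form_eq_jumps[OF le0]
    by (intro sum.cong refl) (simp add: G star_colorings_upd)
  also have "\<dots> = (\<Sum>r\<in>{1..k}. \<Sum>\<sigma>\<in>{\<sigma> \<in> star_colorings b k. \<sigma> 0 = r}. \<Sum>s\<in>{1..k}.
        if s \<in> allowed b k \<sigma> 0 then (g r - g s)\<^sup>2 / real (card (allowed b k \<sigma> 0)) else 0)"
    unfolding sum_by_root
  proof (rule sum.cong[OF refl], rule sum.cong[OF refl])
    fix r \<sigma> assume "\<sigma> \<in> {\<sigma> \<in> star_colorings b k. \<sigma> 0 = r}"
    moreover have "{1..k} \<inter> {s. s \<in> allowed b k \<sigma> 0} = allowed b k \<sigma> 0"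
      by (auto simp: allowed_def)
    ultimately show "(\<Sum>s\<in>allowed b k \<sigma> 0. (g (\<sigma> 0) - g s)\<^sup>2 / real (card (allowed b k \<sigma> 0))) =
       (\<Sum>s\<in>{1..k}. if s \<in> allowed b k \<sigma> 0
          then (g r - g s)\<^sup>2 / real (card (allowed b k \<sigma> 0)) else 0)"
      by (simp add: sum.If_cases)
  qed
  also have "\<dots> = (\<Sum>r\<in>{1..k}. \<Sum>s\<in>{1..k}. \<Sum>\<sigma>\<in>{\<sigma> \<in> star_colorings b k. \<sigma> 0 = r}.
        if s \<in> allowed b k \<sigma> 0 then (g r - g s)\<^sup>2 / real (card (allowed b k \<sigma> 0)) else 0)"
    by (intro sum.cong refl sum.swap)
  also have "\<dots> = (\<Sum>r\<in>{1..k}. \<Sum>s\<in>{1..k}. (g r - g s)\<^sup>2 * ?w r s)"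
  proof (intro sum.cong refl)
    fix r s
    have "{\<sigma> \<in> star_colorings b k. \<sigma> 0 = r} \<inter> {\<sigma>. s \<in> allowed b k \<sigma> 0} =
        {\<sigma> \<in> star_colorings b k. \<sigma> 0 = r \<and> s \<in> allowed b k \<sigma> 0}" by auto
    then show "(\<Sum>\<sigma>\<in>{\<sigma> \<in> star_colorings b k. \<sigma> 0 = r}.
        if s \<in> allowed b k \<sigma> 0 then (g r - g s)\<^sup>2 / real (card (allowed b k \<sigma> 0)) else 0) =
        (g r - g s)\<^sup>2 * ?w r s"
      by (simp add: sum.If_cases sum_distrib_left)
  qed
  also have "\<dots> \<ge> (\<Sum>r\<in>{1..k}. \<Sum>s\<in>{1..k}. (g r - g s)\<^sup>2 * (?n / 3))"
  proof (intro sum_mono)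
    fix r s assume "r \<in> {1..k}" "s \<in> {1..k}"
    \<comment> \<open>The weight bound needs \<open>r \<noteq> s\<close>; on the diagonal both sides
      vanish.\<close>
    then have "r \<noteq> s \<Longrightarrow> ?n / 3 \<le> ?w r s"
      using flip_weight_ge[OF _ _ _ few, of r s] by simp
    then show "(g r - g s)\<^sup>2 * (?n / 3) \<le> (g r - g s)\<^sup>2 * ?w r s"
      by (cases "r = s") (simp, blast intro: mult_left_mono zero_le_power2)
  qed
  also have "(\<Sum>r\<in>{1..k}. \<Sum>s\<in>{1..k}. (g r - g s)\<^sup>2 * (?n / 3)) =
      2 * k * ?n / 3 * (\<Sum>r\<in>{1..k}. (g r)\<^sup>2)"
    unfolding sum_distrib_right[symmetric] sum_pairs_sq_diff g0 by simp
  finally have "k * ?n * (\<Sum>r\<in>{1..k}. (g r)\<^sup>2) \<le> 3 * local_form b k 0 G" by simp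
  then have "?m * (k * ?n * (\<Sum>r\<in>{1..k}. (g r)\<^sup>2)) \<le> ?m * (3 * local_form b k 0 G)"
    by (rule mult_left_mono) simp
  then show ?thesis
    using by_root[of "\<lambda>x. x\<^sup>2"] by (simp add: mult_ac)
qed

section \<open>The Poincare inequality for the whole star\<close>

text \<open>Splitting \<open>f\<close> into \<open>f - g\<close> and \<open>g\<close> costs a factor
  2, the first summand. In \<open>12 = 2 * 3 * 2\<close> the 3 comes from the root inequality and
  the last 2 from replacing \<open>g\<close> by \<open>f\<close> in the root form. The power is the
  inverse of the probability that no leaf has colour \<open>s\<close>, given a root colour
  \<open>r \<noteq> s\<close>.\<close>

definition poincare_const :: "nat \<Rightarrow> nat \<Rightarrow> real" where
  "poincare_const b k = 2 + 12 / real k * (real (k - 1) / real (k - 2)) ^ b"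

lemma poincare_const_ge: "2 \<le> poincare_const b k"
  by (simp add: poincare_const_def)

text \<open>The sweep \<open>g\<close> of \<open>f\<close> depends on the root only, so \<open>f - g\<close> is controlled by the leaves
  and \<open>g\<close> by the root; the passage from \<open>f\<close> to \<open>g\<close> in the form at the root costs
  another \<open>f - g\<close>.\<close>

lemma poincare:
  assumes few: "(k - 2) * (k - 3) ^ b \<le> (k - 2) ^ b"
    and k: "k \<ge> 3"
    and mean: "(\<Sum>\<sigma>\<in>star_colorings b k. f \<sigma>) = 0"
  shows "(\<Sum>\<sigma>\<in>star_colorings b k. (f \<sigma>)\<^sup>2) \<le>
     poincare_const b k * (\<Sum>v\<in>{0..b}. local_form b k v f)"
proof -
  let ?G = "sweep b k b f"
  let ?V = "\<Sum>\<sigma>\<in>star_colorings b k. (f \<sigma> - ?G \<sigma>)\<^sup>2"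
  let ?L = "\<Sum>v\<in>{1..b}. local_form b k v f"
  let ?R = "local_form b k 0 f"
  let ?\<rho> = "(real (k - 1) / real (k - 2)) ^ b"
  \<comment> \<open>Any representative with root colour \<open>r\<close> serves, since the full
    sweep depends on the root only.\<close>
  define g where "g r = ?G (SOME \<sigma>. \<sigma> \<in> star_colorings b k \<and> \<sigma> 0 = r)" for r
  have V: "?V \<le> ?L" by (rule sweep_variance_le) simp
  have g: "?G \<sigma> = g (\<sigma> 0)" if "\<sigma> \<in> star_colorings b k" for \<sigma>
  proof -
    have "\<exists>\<tau>. \<tau> \<in> star_colorings b k \<and> \<tau> 0 = \<sigma> 0" using that by blast
    then show ?thesis
      unfolding g_def using someI_ex[of "\<lambda>\<tau>. \<tau> \<in> star_colorings b k \<and> \<tau> 0 = \<sigma> 0"]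
      by (intro sweep_root that) auto
  qed
  have "real k * real (k - 2) ^ b * (\<Sum>\<sigma>\<in>star_colorings b k. (?G \<sigma>)\<^sup>2) \<le>
     3 * real (k - 1) ^ b * local_form b k 0 ?G"
    using k by (intro root_poincare[where g = g] few g) (auto simp: sum_sweep mean)
  moreover have "0 < real k * real (k - 2) ^ b" using k by simp
  moreover have "S \<le> 3 / x * (y / z) * d" if "x * z * S \<le> 3 * y * d" "0 < x * z" for S d x y z :: real
    using that by (simp add: pos_le_divide_eq mult_ac)
  ultimately have G: "(\<Sum>\<sigma>\<in>star_colorings b k. (?G \<sigma>)\<^sup>2) \<le> 3 / real k * ?\<rho> * local_form b k 0 ?G"
    unfolding power_divide by blast
  have "local_form b k 0 ?G = local_form b k 0 (\<lambda>\<sigma>. f \<sigma> - (f \<sigma> - ?G \<sigma>))"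
    by simp
  also have "\<dots> \<le> 2 * ?R + 2 * local_form b k 0 (\<lambda>\<sigma>. f \<sigma> - ?G \<sigma>)"
    by (rule local_form_diff_le) simp
  also have "\<dots> \<le> 2 * ?R + 2 * ?V"
    using local_form_le_sq[of 0 b k "\<lambda>\<sigma>. f \<sigma> - ?G \<sigma>"] by simp
  also have "\<dots> \<le> 2 * (?R + ?L)" using V by simp
  finally have H: "3 / real k * ?\<rho> * local_form b k 0 ?G \<le> 3 / real k * ?\<rho> * (2 * (?R + ?L))"
    by (rule mult_left_mono) simp
  have e: "3 / real k * ?\<rho> * (2 * x) = 6 / real k * ?\<rho> * x" for x
    by simp
  have G': "(\<Sum>\<sigma>\<in>star_colorings b k. (?G \<sigma>)\<^sup>2) \<le> 6 / real k * ?\<rho> * (?R + ?L)"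
    using order_trans[OF G H] unfolding e .
  have "(f \<sigma>)\<^sup>2 \<le> 2 * (f \<sigma> - ?G \<sigma>)\<^sup>2 + 2 * (?G \<sigma>)\<^sup>2" for \<sigma>
    using zero_le_power2[of "f \<sigma> - 2 * ?G \<sigma>"] by (simp add: power2_diff power_mult_distrib)
  then have "(\<Sum>\<sigma>\<in>star_colorings b k. (f \<sigma>)\<^sup>2) \<le>
      (\<Sum>\<sigma>\<in>star_colorings b k. 2 * (f \<sigma> - ?G \<sigma>)\<^sup>2 + 2 * (?G \<sigma>)\<^sup>2)"
    by (rule sum_mono)
  also have "\<dots> = 2 * ?V + 2 * (\<Sum>\<sigma>\<in>star_colorings b k. (?G \<sigma>)\<^sup>2)"
    by (simp add: sum.distrib sum_distrib_left)
  also have "\<dots> \<le> 2 * (?R + ?L) + 2 * (6 / real k * ?\<rho> * (?R + ?L))"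
    using V local_form_nonneg[OF le0, of b k f] by (intro add_mono mult_left_mono G') simp_all
  also have "\<dots> = poincare_const b k * (?R + ?L)"
    unfolding poincare_const_def distrib_right by simp
  also have "?R + ?L = (\<Sum>v\<in>{0..b}. local_form b k v f)"
    by (simp add: sum.atLeast_Suc_atMost)
  finally show ?thesis .
qed

section \<open>The transition matrix and its contraction\<close>

text \<open>For fixed \<open>v\<close> the nonzero terms belong to the colourings
  \<open>\<sigma>(v := c)\<close> with \<open>c\<close> allowed, each hit once. Hence the matrix
  acts as the average of \<open>b + 1\<close> conditional expectations.\<close>

lemma glauber_apply:
  assumes s: "\<sigma> \<in> star_colorings b k"
  shows "(\<Sum>\<tau>\<in>star_colorings b k. glauber_P b k \<sigma> \<tau> * f \<tau>) =
    (\<Sum>v\<in>{0..b}. resample b k v f \<sigma>) / real (b + 1)"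
proof -
  let ?c = "\<lambda>v \<tau>. (\<forall>u. u \<noteq> v \<longrightarrow> \<sigma> u = \<tau> u) \<and> \<tau> v \<in> allowed b k \<sigma> v"
  let ?n = "\<lambda>v. real (card (allowed b k \<sigma> v))"
  have "(\<Sum>\<tau>\<in>star_colorings b k. glauber_P b k \<sigma> \<tau> * f \<tau>) =
     (\<Sum>\<tau>\<in>star_colorings b k. \<Sum>v\<in>{0..b}. if ?c v \<tau> then f \<tau> / ?n v else 0) / real (b + 1)"
    unfolding glauber_P_def sum_divide_distrib sum_distrib_left sum_distrib_right
    by (intro sum.cong refl) auto
  also have "(\<Sum>\<tau>\<in>star_colorings b k. \<Sum>v\<in>{0..b}. if ?c v \<tau> then f \<tau> / ?n v else 0) =
     (\<Sum>v\<in>{0..b}. \<Sum>\<tau>\<in>star_colorings b k. if ?c v \<tau> then f \<tau> / ?n v else 0)"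
    by (rule sum.swap)
  also have "\<dots> = (\<Sum>v\<in>{0..b}. resample b k v f \<sigma>)"
  proof (rule sum.cong[OF refl])
    fix v assume "v \<in> {0..b}"
    then have v: "v \<le> b" by simp
    have eq: "{\<tau> \<in> star_colorings b k. ?c v \<tau>} = (\<lambda>c. \<sigma>(v := c)) ` allowed b k \<sigma> v"
    proof (intro equalityI subsetI)
      fix \<tau> assume "\<tau> \<in> {\<tau> \<in> star_colorings b k. ?c v \<tau>}"
      then have "\<tau> = \<sigma>(v := \<tau> v)" "\<tau> v \<in> allowed b k \<sigma> v" by (auto simp: fun_eq_iff)
      then show "\<tau> \<in> (\<lambda>c. \<sigma>(v := c)) ` allowed b k \<sigma> v" by blast
    qed (use star_colorings_upd[OF s v] in auto)
    have inj: "inj_on (\<lambda>c. \<sigma>(v := c)) (allowed b k \<sigma> v)"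
      by (rule inj_onI) (metis fun_upd_same)
    have "(\<Sum>\<tau>\<in>star_colorings b k. if ?c v \<tau> then f \<tau> / ?n v else 0) =
        (\<Sum>\<tau>\<in>{\<tau> \<in> star_colorings b k. ?c v \<tau>}. f \<tau> / ?n v)"
      by (rule sum.inter_filter[symmetric]) simp
    also have "\<dots> = resample b k v f \<sigma>"
      unfolding eq sum.reindex[OF inj] by (simp add: resample_def sum_divide_distrib)
    finally show "(\<Sum>\<tau>\<in>star_colorings b k. if ?c v \<tau> then f \<tau> / ?n v else 0) =
        resample b k v f \<sigma>" .
  qed
  finally show ?thesis .
qed

lemma glauber_P_nonneg: "0 \<le> glauber_P b k \<sigma> \<tau>"
  by (simp add: glauber_P_def sum_nonneg)

lemma glauber_P_sym:
  assumes "\<sigma> \<in> star_colorings b k" "\<tau> \<in> star_colorings b k"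
  shows "glauber_P b k \<sigma> \<tau> = glauber_P b k \<tau> \<sigma>"
proof -
  have "(if (\<forall>u. u \<noteq> v \<longrightarrow> \<sigma> u = \<tau> u) \<and> \<tau> v \<in> allowed b k \<sigma> v
           then 1 / real (card (allowed b k \<sigma> v)) else 0) =
        (if (\<forall>u. u \<noteq> v \<longrightarrow> \<tau> u = \<sigma> u) \<and> \<sigma> v \<in> allowed b k \<tau> v
           then 1 / real (card (allowed b k \<tau> v)) else 0)" if "v \<in> {0..b}" for v
  proof (cases "\<forall>u. u \<noteq> v \<longrightarrow> \<sigma> u = \<tau> u")
    case True
    then have "\<tau> = \<sigma>(v := \<tau> v)" by (auto simp: fun_eq_iff)
    then have "allowed b k \<tau> v = allowed b k \<sigma> v" by (metis allowed_upd)
    then show ?thesis using True that assms self_allowed by auto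
  next
    case False
    then have "\<not> (\<forall>u. u \<noteq> v \<longrightarrow> \<tau> u = \<sigma> u)" by metis
    then show ?thesis using False by auto
  qed
  then show ?thesis
    unfolding glauber_P_def by (rule arg_cong2[where f = "(*)", OF refl sum.cong[OF refl]])
qed

lemma glauber_P_row_sum:
  assumes "\<sigma> \<in> star_colorings b k"
  shows "(\<Sum>\<tau>\<in>star_colorings b k. glauber_P b k \<sigma> \<tau>) = 1"
proof -
  have "resample b k v (\<lambda>_. 1) \<sigma> = 1" if "v \<in> {0..b}" for v
    using that assms by (intro resample_const) simp_all
  then show ?thesis
    using glauber_apply[OF assms, of "\<lambda>_. 1"] by simp
qed

lemma glauber_P_column_sum:
  assumes "\<tau> \<in> star_colorings b k"
  shows "(\<Sum>\<sigma>\<in>star_colorings b k. glauber_P b k \<sigma> \<tau>) = 1"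
  using glauber_P_row_sum[OF assms] glauber_P_sym[OF assms] by (simp cong: sum.cong)

text \<open>A lower bound for the spectral gap, not the gap itself: the Dirichlet form of the chain
  is the sum of the local forms divided by \<open>b + 1\<close>.\<close>

definition gap :: "nat \<Rightarrow> nat \<Rightarrow> real" where
  "gap b k = 1 / (real (b + 1) * poincare_const b k)"

lemma gap_bounds: "0 < gap b k" "gap b k \<le> 1"
proof -
  have "1 * 1 \<le> real (b + 1) * poincare_const b k"
    using poincare_const_ge[of b k] by (intro mult_mono) auto
  then show "0 < gap b k" "gap b k \<le> 1" by (auto simp: gap_def)
qed

text \<open>Convexity replaces the spectral theorem here, at the price of a factor 2 in the rate:
  each resampling is an orthogonal projection, so \<open>\<parallel>E f\<parallel>\<^sup>2 = \<parallel>f\<parallel>\<^sup>2 - local_form f\<close>.\<close>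

lemma glauber_contract:
  assumes few: "(k - 2) * (k - 3) ^ b \<le> (k - 2) ^ b"
    and k: "k \<ge> 3"
    and mean: "(\<Sum>\<sigma>\<in>star_colorings b k. f \<sigma>) = 0"
  shows "(\<Sum>\<sigma>\<in>star_colorings b k. (\<Sum>\<tau>\<in>star_colorings b k. glauber_P b k \<sigma> \<tau> * f \<tau>)\<^sup>2) \<le>
     (1 - gap b k) * (\<Sum>\<sigma>\<in>star_colorings b k. (f \<sigma>)\<^sup>2)"
proof -
  let ?n = "real (b + 1)"
  let ?F = "\<Sum>\<sigma>\<in>star_colorings b k. (f \<sigma>)\<^sup>2"
  have conv: "(\<Sum>\<tau>\<in>star_colorings b k. glauber_P b k \<sigma> \<tau> * f \<tau>)\<^sup>2 \<le>
      (\<Sum>v\<in>{0..b}. (resample b k v f \<sigma>)\<^sup>2) / ?n"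
    if s: "\<sigma> \<in> star_colorings b k" for \<sigma>
  proof -
    have "(\<Sum>v\<in>{0..b}. resample b k v f \<sigma>)\<^sup>2 \<le> (\<Sum>v\<in>{0..b}. (resample b k v f \<sigma>)\<^sup>2) * ?n"
      using sum_squared_le_sum_of_squares[of "\<lambda>v. resample b k v f \<sigma>" "{0..b}"] by simp
    then have "(\<Sum>v\<in>{0..b}. resample b k v f \<sigma>)\<^sup>2 / ?n\<^sup>2 \<le>
        ((\<Sum>v\<in>{0..b}. (resample b k v f \<sigma>)\<^sup>2) * ?n) / ?n\<^sup>2"
      by (rule divide_right_mono) simp
    also have "\<dots> = (\<Sum>v\<in>{0..b}. (resample b k v f \<sigma>)\<^sup>2) / ?n"
      unfolding power2_eq_square by (rule mult_divide_mult_cancel_right) simp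
    finally show ?thesis unfolding glauber_apply[OF s] power_divide .
  qed
  have sq: "(\<Sum>\<sigma>\<in>star_colorings b k. (resample b k v f \<sigma>)\<^sup>2) = ?F - local_form b k v f"
    if "v \<in> {0..b}" for v
    using sum_resample_sq[of v b k f] that
    by (simp add: local_form_def right_diff_distrib sum_subtractf power2_eq_square)
  have "(\<Sum>\<sigma>\<in>star_colorings b k. (\<Sum>\<tau>\<in>star_colorings b k. glauber_P b k \<sigma> \<tau> * f \<tau>)\<^sup>2) \<le>
      (\<Sum>\<sigma>\<in>star_colorings b k. (\<Sum>v\<in>{0..b}. (resample b k v f \<sigma>)\<^sup>2) / ?n)"
    by (rule sum_mono) (rule conv)
  also have "\<dots> = (\<Sum>v\<in>{0..b}. \<Sum>\<sigma>\<in>star_colorings b k. (resample b k v f \<sigma>)\<^sup>2) / ?n"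
    unfolding sum_divide_distrib[symmetric] by (subst sum.swap) (rule refl)
  also have "\<dots> = (?n * ?F - (\<Sum>v\<in>{0..b}. local_form b k v f)) / ?n"
    by (simp add: sq sum_subtractf)
  also have "\<dots> = ?F - (\<Sum>v\<in>{0..b}. local_form b k v f) / ?n"
    by (simp add: diff_divide_distrib)
  also have "\<dots> \<le> ?F - gap b k * ?F"
  proof -
    have "gap b k * ?F \<le> gap b k * (poincare_const b k * (\<Sum>v\<in>{0..b}. local_form b k v f))"
      using gap_bounds by (intro mult_left_mono poincare few k mean) (simp add: less_imp_le)
    also have "\<dots> = (\<Sum>v\<in>{0..b}. local_form b k v f) / ?n"
      using poincare_const_ge[of b k] by (simp add: gap_def)
    finally show ?thesis by simp
  qed
  finally show ?thesis by (simp add: algebra_simps)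
qed

section \<open>Powers of the matrix and the burn-in of the leaves\<close>

lemma glauber_Pt_nonneg: "0 \<le> glauber_Pt b k t \<sigma> \<tau>"
  by (induction t arbitrary: \<tau>) (simp_all add: sum_nonneg glauber_P_nonneg)

lemma glauber_Pt_Suc_apply:
  "(\<Sum>\<tau>\<in>star_colorings b k. glauber_Pt b k (Suc t) \<sigma> \<tau> * f \<tau>) =
   (\<Sum>\<rho>\<in>star_colorings b k. glauber_Pt b k t \<sigma> \<rho> *
      (\<Sum>\<tau>\<in>star_colorings b k. glauber_P b k \<rho> \<tau> * f \<tau>))"
  by (simp add: sum_distrib_left sum_distrib_right mult.assoc)
     (rule sum.swap)

lemma glauber_Pt_row_sum:
  assumes "\<sigma> \<in> star_colorings b k"
  shows "(\<Sum>\<tau>\<in>star_colorings b k. glauber_Pt b k t \<sigma> \<tau>) = 1"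
proof (induction t)
  case 0
  then show ?case using assms by simp
next
  case (Suc t)
  then show ?case
    using glauber_Pt_Suc_apply[of b k t \<sigma> "\<lambda>_. 1"] glauber_P_row_sum by (simp cong: sum.cong)
qed

text \<open>The target is \<open>S = {1..b}\<close>. Smaller sets enter because resampling a leaf
  \<open>v\<close> of \<open>S\<close> leaves a condition on \<open>S - {v}\<close> only.\<close>

definition agree :: "(nat \<Rightarrow> nat) \<Rightarrow> nat set \<Rightarrow> (nat \<Rightarrow> nat) \<Rightarrow> real" where
  "agree x S \<sigma> = (if \<forall>i\<in>S. \<sigma> i = x i then 1 else 0)"

lemma resample_agree_notin:
  assumes "\<sigma> \<in> star_colorings b k" "v \<le> b" "v \<notin> S"
  shows "resample b k v (agree x S) \<sigma> = agree x S \<sigma>"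
  using assms by (intro resample_const) (auto simp: agree_def)

text \<open>Only an inequality, as \<open>x v\<close> may be the root colour and then has
  probability 0. The bound ignores which colour the root has, so the root need not be
  tracked.\<close>

lemma resample_agree_in:
  assumes s: "\<sigma> \<in> star_colorings b k" and v: "v \<in> S" "S \<subseteq> {1..b}"
  shows "resample b k v (agree x S) \<sigma> \<le> agree x (S - {v}) \<sigma> / real (k - 1)"
proof -
  have v': "v \<in> {1..b}" using v by blast
  have "\<sigma> 0 \<in> {1..k}" using s by (auto simp: star_colorings_iff)
  then have c: "card (allowed b k \<sigma> v) = k - 1" by (simp add: allowed_leaf[OF v'])
  have "(\<Sum>c\<in>allowed b k \<sigma> v. agree x S (\<sigma>(v := c))) =
      (\<Sum>c\<in>allowed b k \<sigma> v. if c = x v then agree x (S - {v}) \<sigma> else 0)"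
    by (intro sum.cong refl) (use v in \<open>auto simp: agree_def\<close>)
  also have "\<dots> \<le> agree x (S - {v}) \<sigma>"
    by (simp add: agree_def)
  finally show ?thesis
    unfolding resample_def c by (rule divide_right_mono) simp
qed

text \<open>With \<open>q = (1 - 1 / (b + 1)) ^ t\<close>, the probability that a given vertex was not picked in \<open>t\<close>
  steps, \<open>stale / (k - 1)\<close> is the upper bound \<open>q + (1 - q) / (k - 1)\<close> for a leaf to carry a given
  colour at time \<open>t\<close>. Bernoulli's inequality shows that leaves may be treated as independent.\<close>

definition stale :: "nat \<Rightarrow> nat \<Rightarrow> nat \<Rightarrow> real" where
  "stale b k t = 1 + real (k - 2) * (1 - 1 / real (b + 1)) ^ t"

lemma stale_Suc: "stale b k (Suc t) = stale b k t - (stale b k t - 1) / real (b + 1)"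
  by (simp add: stale_def algebra_simps)

lemma stale_ge: "1 \<le> stale b k t"
  by (simp add: stale_def)

lemma agree_prob_le:
  assumes k: "k \<ge> 3"
  shows "\<lbrakk>\<sigma> \<in> star_colorings b k; S \<subseteq> {1..b}\<rbrakk> \<Longrightarrow>
    (\<Sum>\<tau>\<in>star_colorings b k. glauber_Pt b k t \<sigma> \<tau> * agree x S \<tau>) \<le>
      (stale b k t / real (k - 1)) ^ card S"
proof (induction t arbitrary: S)
  case 0
  have "stale b k 0 = real (k - 1)" using k by (simp add: stale_def)
  then have 1: "stale b k 0 / real (k - 1) = 1" using k by simp
  have 2: "(\<Sum>\<tau>\<in>star_colorings b k. glauber_Pt b k 0 \<sigma> \<tau> * agree x S \<tau>) = agree x S \<sigma>"
    using 0 by (simp add: if_distrib[of "\<lambda>a. a * _"] cong: if_cong)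
  show ?case unfolding 1 2 power_one by (simp add: agree_def)
next
  case (Suc t)
  let ?n = "card S" and ?N = "real (b + 1)" and ?m = "real (k - 1)"
  let ?z = "stale b k t"
  let ?A = "\<lambda>S. \<Sum>\<tau>\<in>star_colorings b k. glauber_Pt b k t \<sigma> \<tau> * agree x S \<tau>"
  have fS: "finite S" using Suc.prems finite_subset by blast
  have m: "0 < ?m" using k by simp
  have z: "1 \<le> ?z" by (rule stale_ge)
  have nb: "?n \<le> b" using Suc.prems(2) card_mono[of "{1..b}" S] by simp
  have step: "(\<Sum>\<tau>\<in>star_colorings b k. glauber_P b k \<rho> \<tau> * agree x S \<tau>) \<le>
      ((?N - real ?n) * agree x S \<rho> + (\<Sum>v\<in>S. agree x (S - {v}) \<rho> / ?m)) / ?N"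
    if r: "\<rho> \<in> star_colorings b k" for \<rho>
  proof -
    have sub: "S \<subseteq> {0..b}" using Suc.prems(2) by auto
    have "(\<Sum>v\<in>{0..b}. resample b k v (agree x S) \<rho>) =
        (\<Sum>v\<in>{0..b} - S. resample b k v (agree x S) \<rho>) + (\<Sum>v\<in>S. resample b k v (agree x S) \<rho>)"
      by (rule sum.subset_diff[OF sub]) simp
    also have "(\<Sum>v\<in>{0..b} - S. resample b k v (agree x S) \<rho>) = (\<Sum>v\<in>{0..b} - S. agree x S \<rho>)"
      by (rule sum.cong) (auto intro: resample_agree_notin r)
    also have "\<dots> = (?N - real ?n) * agree x S \<rho>"
      using nb by (simp add: card_Diff_subset fS sub of_nat_diff)
    also have "(\<Sum>v\<in>S. resample b k v (agree x S) \<rho>) \<le> (\<Sum>v\<in>S. agree x (S - {v}) \<rho> / ?m)"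
      by (rule sum_mono) (rule resample_agree_in[OF r _ Suc.prems(2)])
    finally show ?thesis
      unfolding glauber_apply[OF r] by (intro divide_right_mono) auto
  qed
  have "(\<Sum>\<tau>\<in>star_colorings b k. glauber_Pt b k (Suc t) \<sigma> \<tau> * agree x S \<tau>) \<le>
     (\<Sum>\<rho>\<in>star_colorings b k. glauber_Pt b k t \<sigma> \<rho> *
        (((?N - real ?n) * agree x S \<rho> + (\<Sum>v\<in>S. agree x (S - {v}) \<rho> / ?m)) / ?N))"
    unfolding glauber_Pt_Suc_apply
    by (intro sum_mono mult_left_mono step glauber_Pt_nonneg)
  also have "\<dots> = ((?N - real ?n) * ?A S + (\<Sum>v\<in>S. ?A (S - {v}) / ?m)) / ?N"
  proof -
    have "(\<Sum>v\<in>S. ?A (S - {v}) / ?m) =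
        (\<Sum>\<rho>\<in>star_colorings b k. glauber_Pt b k t \<sigma> \<rho> * (\<Sum>v\<in>S. agree x (S - {v}) \<rho> / ?m))"
      by (simp only: sum_distrib_left sum_divide_distrib times_divide_eq_right) (rule sum.swap)
    moreover have "(?N - real ?n) * ?A S =
        (\<Sum>\<rho>\<in>star_colorings b k. glauber_Pt b k t \<sigma> \<rho> * ((?N - real ?n) * agree x S \<rho>))"
      by (simp only: sum_distrib_left mult.left_commute)
    ultimately show ?thesis
      by (simp only: sum_divide_distrib[symmetric] times_divide_eq_right distrib_left sum.distrib)
  qed
  also have "\<dots> \<le> ((?N - real ?n) * (?z / ?m) ^ ?n + (\<Sum>v\<in>S. (?z / ?m) ^ (?n - 1) / ?m)) / ?N"
  proof (intro divide_right_mono add_mono mult_left_mono sum_mono)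
    show "?A S \<le> (?z / ?m) ^ ?n" by (rule Suc.IH[OF Suc.prems])
    show "?A (S - {v}) \<le> (?z / ?m) ^ (?n - 1)" if "v \<in> S" for v
      using Suc.IH[OF Suc.prems(1), of "S - {v}"] Suc.prems(2) that by (auto simp: fS)
  qed (use nb m in auto)
  \<comment> \<open>A leaf of \<open>S\<close> is picked with probability \<open>1 / ?N\<close>, and
    its factor \<open>?z / ?m\<close> then drops to \<open>1 / ?m\<close>, a relative loss of
    \<open>1 - 1 / ?z\<close>; losses of distinct leaves add up within one step.\<close>
  also have "\<dots> = (?z / ?m) ^ ?n * (1 + real ?n * (- ((1 - 1 / ?z) / ?N)))"
  proof (cases ?n)
    case 0
    then show ?thesis by simp
  next
    case (Suc j)
    have *: "((M - a) * (c / d) ^ Suc j + a * ((c / d) ^ j / d)) / M =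
        (c / d) ^ Suc j * (1 + a * (- ((1 - 1 / c) / M)))"
      if "0 < M" "0 < c" "0 < d" for M a c d :: real
    proof -
      have "(c / d) ^ j / d = (c / d) ^ Suc j / c" using that by simp
      then show ?thesis using that by (simp add: field_simps)
    qed
    have "(\<Sum>v\<in>S. (?z / ?m) ^ (?n - 1) / ?m) = real (Suc j) * ((?z / ?m) ^ j / ?m)"
      using Suc by simp
    then show ?thesis
      unfolding Suc by (simp only:) (rule *, use z m in auto)
  qed
  also have "\<dots> \<le> (?z / ?m) ^ ?n * (1 + - ((1 - 1 / ?z) / ?N)) ^ ?n"
  proof (intro mult_left_mono Bernoulli_inequality)
    have "(1 - 1 / ?z) / ?N \<le> 1 / 1"
      using z by (intro frac_le) auto
    then show "-1 \<le> - ((1 - 1 / ?z) / ?N)" by simp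
  qed (use z m in auto)
  also have "\<dots> = (stale b k (Suc t) / ?m) ^ ?n"
  proof -
    have "?z * (1 + - ((1 - 1 / ?z) / ?N)) = stale b k (Suc t)"
    proof -
      have *: "c * (1 + - ((1 - 1 / c) / M)) = c - (c - 1) / M" if "1 \<le> c" "0 < M" for c M :: real
        using that by (simp add: field_simps)
      show ?thesis unfolding stale_Suc by (rule *[OF z]) simp
    qed
    then show ?thesis
      by (simp only: power_mult_distrib[symmetric] times_divide_eq_left)
  qed
  finally show ?case .
qed

text \<open>The event of being at \<open>x\<close> is enlarged to agreement on all leaves.
  Forgetting the root is what leaves the factor \<open>k\<close> relative to the uniform
  weight.\<close>

lemma glauber_Pt_le:
  assumes k: "k \<ge> 3" and s: "\<sigma> \<in> star_colorings b k" and x: "x \<in> star_colorings b k"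
  shows "glauber_Pt b k t \<sigma> x \<le> (stale b k t / real (k - 1)) ^ b"
proof -
  have "glauber_Pt b k t \<sigma> x * agree x {1..b} x \<le>
      (\<Sum>\<tau>\<in>star_colorings b k. glauber_Pt b k t \<sigma> \<tau> * agree x {1..b} \<tau>)"
    using x by (intro member_le_sum) (auto simp: glauber_Pt_nonneg agree_def)
  also have "\<dots> \<le> (stale b k t / real (k - 1)) ^ card {1..b}"
    by (rule agree_prob_le[OF k s]) simp
  finally show ?thesis by (simp add: agree_def)
qed

section \<open>From L2 decay to total variation\<close>

text \<open>By symmetry the deviation from uniform evolves as a function under the matrix, and it
  always has mean zero, so the contraction iterates from any time \<open>t\<close>.\<close>

lemma l2_decay:
  assumes few: "(k - 2) * (k - 3) ^ b \<le> (k - 2) ^ b" and k: "k \<ge> 3"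
    and s: "\<sigma> \<in> star_colorings b k"
  defines "u \<equiv> \<lambda>t \<tau>. glauber_Pt b k t \<sigma> \<tau> - 1 / real (card (star_colorings b k))"
  shows "(\<Sum>\<tau>\<in>star_colorings b k. (u (t + j) \<tau>)\<^sup>2) \<le>
     (1 - gap b k) ^ j * (\<Sum>\<tau>\<in>star_colorings b k. (u t \<tau>)\<^sup>2)"
proof (induction j)
  case 0
  then show ?case by simp
next
  case (Suc j)
  have "card (star_colorings b k) \<noteq> 0" using s by auto
  then have mean: "(\<Sum>\<tau>\<in>star_colorings b k. u (t + j) \<tau>) = 0"
    by (simp add: u_def sum_subtractf glauber_Pt_row_sum[OF s])
  have "u (Suc (t + j)) \<tau> = (\<Sum>\<rho>\<in>star_colorings b k. glauber_P b k \<tau> \<rho> * u (t + j) \<rho>)"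
    if t: "\<tau> \<in> star_colorings b k" for \<tau>
  proof -
    have "u (Suc (t + j)) \<tau> = (\<Sum>\<rho>\<in>star_colorings b k. u (t + j) \<rho> * glauber_P b k \<rho> \<tau>)"
      using glauber_P_column_sum[OF t]
      by (simp add: u_def left_diff_distrib sum_subtractf sum_divide_distrib[symmetric])
    then show ?thesis
      using glauber_P_sym[OF _ t] by (simp add: mult.commute cong: sum.cong)
  qed
  then have "(\<Sum>\<tau>\<in>star_colorings b k. (u (t + Suc j) \<tau>)\<^sup>2) =
     (\<Sum>\<tau>\<in>star_colorings b k. (\<Sum>\<rho>\<in>star_colorings b k. glauber_P b k \<tau> \<rho> * u (t + j) \<rho>)\<^sup>2)"
    by simp
  also have "\<dots> \<le> (1 - gap b k) * (\<Sum>\<tau>\<in>star_colorings b k. (u (t + j) \<tau>)\<^sup>2)"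
    by (rule glauber_contract[OF few k mean])
  also have "\<dots> \<le> (1 - gap b k) * ((1 - gap b k) ^ j * (\<Sum>\<tau>\<in>star_colorings b k. (u t \<tau>)\<^sup>2))"
    using gap_bounds by (intro mult_left_mono Suc.IH) simp
  finally show ?case by simp
qed

text \<open>Here \<open>t\<close> is the burn-in and \<open>j\<close> the decay phase.
  Cauchy--Schwarz brings in the number of colourings \<open>k * ?M\<close>, which cancels
  \<open>?M\<close> in the initial bound \<open>exp 1 / ?M\<close>.\<close>

lemma tv_le:
  assumes few: "(k - 2) * (k - 3) ^ b \<le> (k - 2) ^ b" and k: "k \<ge> 3"
    and s: "\<sigma> \<in> star_colorings b k"
    and T1: "stale b k t ^ b \<le> exp 1"
    and T2: "exp 1 * real k * (1 - gap b k) ^ j \<le> (1 / exp 1)\<^sup>2"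
  shows "tv_to_uniform b k (t + j) \<sigma> \<le> 1 / (2 * exp 1)"
proof -
  let ?N = "real (card (star_colorings b k))"
  let ?M = "real (k - 1) ^ b"
  let ?u = "\<lambda>t \<tau>. glauber_Pt b k t \<sigma> \<tau> - 1 / ?N"
  have M: "0 < ?M" using k by simp
  have N: "?N = real k * ?M" by (simp add: card_star_colorings del: of_nat_diff)
  have N0: "0 < ?N" unfolding N using k M by simp
  have "(?u t \<tau>)\<^sup>2 = (glauber_Pt b k t \<sigma> \<tau>)\<^sup>2 - 2 / ?N * glauber_Pt b k t \<sigma> \<tau> + (1 / ?N)\<^sup>2" for \<tau>
    by (simp add: power2_diff)
  then have "(\<Sum>\<tau>\<in>star_colorings b k. (?u t \<tau>)\<^sup>2) =
     (\<Sum>\<tau>\<in>star_colorings b k. (glauber_Pt b k t \<sigma> \<tau>)\<^sup>2) - 2 / ?N + ?N * (1 / ?N)\<^sup>2"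
    by (simp only: sum.distrib sum_subtractf sum_distrib_left[symmetric] glauber_Pt_row_sum[OF s]
        sum_constant mult_1_right)
  also have "\<dots> \<le> (\<Sum>\<tau>\<in>star_colorings b k. (glauber_Pt b k t \<sigma> \<tau>)\<^sup>2)"
  proof -
    have "?N * (1 / ?N)\<^sup>2 = 1 / ?N" using N0 by (simp add: power2_eq_square)
    moreover have "1 / ?N \<le> 2 / ?N" by (intro divide_right_mono) auto
    ultimately show ?thesis by linarith
  qed
  \<comment> \<open>One factor of the square is bounded pointwise; the other sums to 1.\<close>
  also have "\<dots> \<le> (\<Sum>\<tau>\<in>star_colorings b k. exp 1 / ?M * glauber_Pt b k t \<sigma> \<tau>)"
    unfolding power2_eq_square
  proof (intro sum_mono mult_right_mono glauber_Pt_nonneg)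
    fix \<tau> assume t: "\<tau> \<in> star_colorings b k"
    have "glauber_Pt b k t \<sigma> \<tau> \<le> stale b k t ^ b / ?M"
      using glauber_Pt_le[OF k s t] by (simp only: power_divide)
    also have "\<dots> \<le> exp 1 / ?M" using T1 M by (intro divide_right_mono) auto
    finally show "glauber_Pt b k t \<sigma> \<tau> \<le> exp 1 / ?M" .
  qed
  also have "\<dots> = exp 1 / ?M"
    unfolding sum_distrib_left[symmetric] glauber_Pt_row_sum[OF s] by simp
  finally have u: "(\<Sum>\<tau>\<in>star_colorings b k. (?u t \<tau>)\<^sup>2) \<le> exp 1 / ?M" .
  have "(\<Sum>\<tau>\<in>star_colorings b k. \<bar>?u (t + j) \<tau>\<bar>)\<^sup>2 \<le>
      (\<Sum>\<tau>\<in>star_colorings b k. (?u (t + j) \<tau>)\<^sup>2) * ?N"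
    using sum_squared_le_sum_of_squares[of "\<lambda>\<tau>. \<bar>?u (t + j) \<tau>\<bar>" "star_colorings b k"] by simp
  also have "\<dots> \<le> ((1 - gap b k) ^ j * (exp 1 / ?M)) * ?N"
  proof (rule mult_right_mono)
    have "(\<Sum>\<tau>\<in>star_colorings b k. (?u (t + j) \<tau>)\<^sup>2) \<le>
        (1 - gap b k) ^ j * (\<Sum>\<tau>\<in>star_colorings b k. (?u t \<tau>)\<^sup>2)"
      by (rule l2_decay[OF few k s])
    also have "\<dots> \<le> (1 - gap b k) ^ j * (exp 1 / ?M)"
      using gap_bounds by (intro mult_left_mono u) simp
    finally show "(\<Sum>\<tau>\<in>star_colorings b k. (?u (t + j) \<tau>)\<^sup>2) \<le> (1 - gap b k) ^ j * (exp 1 / ?M)" .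
  qed simp
  also have "\<dots> = exp 1 * real k * (1 - gap b k) ^ j"
  proof -
    have *: "(g * (e / m)) * (a * m) = e * a * g" if "0 < m" for a e g m :: real
      using that by simp
    show ?thesis unfolding N by (rule *[OF M])
  qed
  also have "\<dots> \<le> (1 / exp 1)\<^sup>2" by (rule T2)
  finally have "(\<Sum>\<tau>\<in>star_colorings b k. \<bar>?u (t + j) \<tau>\<bar>) \<le> 1 / exp 1"
    by (rule power2_le_imp_le) simp
  then show ?thesis by (simp add: tv_to_uniform_def field_simps)
qed

lemma mixing_time_le:
  assumes "\<And>\<sigma>. \<sigma> \<in> star_colorings b k \<Longrightarrow> tv_to_uniform b k t \<sigma> \<le> 1 / (2 * exp 1)"
  shows "mixing_time b k \<le> t"
  unfolding mixing_time_def by (rule Least_le) (use assms in blast)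

section \<open>Eigenvalues and the relaxation time\<close>

lemma eigenvalue_sum_zero:
  assumes "\<forall>\<sigma>\<in>star_colorings b k. (\<Sum>\<tau>\<in>star_colorings b k. glauber_P b k \<sigma> \<tau> * f \<tau>) = l * f \<sigma>"
    and "l \<noteq> 1"
  shows "(\<Sum>\<sigma>\<in>star_colorings b k. f \<sigma>) = 0"
proof -
  have "l * (\<Sum>\<sigma>\<in>star_colorings b k. f \<sigma>) =
      (\<Sum>\<sigma>\<in>star_colorings b k. \<Sum>\<tau>\<in>star_colorings b k. glauber_P b k \<sigma> \<tau> * f \<tau>)"
    using assms(1) by (simp add: sum_distrib_left)
  also have "\<dots> = (\<Sum>\<tau>\<in>star_colorings b k. (\<Sum>\<sigma>\<in>star_colorings b k. glauber_P b k \<sigma> \<tau>) * f \<tau>)"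
    unfolding sum_distrib_right by (rule sum.swap)
  also have "\<dots> = (\<Sum>\<tau>\<in>star_colorings b k. f \<tau>)"
    by (simp add: glauber_P_column_sum)
  finally show ?thesis using assms(2) by simp
qed

text \<open>Needed because \<open>Sup {}\<close> is unspecified on the reals.\<close>

lemma ex_nontrivial_eigenvalue:
  assumes b: "b \<ge> 2" and k: "k \<ge> 3"
  shows "nontrivial_eigenvalue b k (real b / real (b + 1))"
proof -
  define h :: "nat \<Rightarrow> real" where "h c = (if c = 1 then 1 else 0)" for c
  \<comment> \<open>Resampling leaf 1 or leaf 2 replaces its term by the same average
    \<open>?H\<close>, so the two results add up to \<open>f\<close>; the other \<open>b - 1\<close>
    vertices, root included, leave \<open>f\<close> fixed. The total is \<open>b\<close> times
    \<open>f\<close>.\<close>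
  define f where "f \<sigma> = h (\<sigma> 1) - h (\<sigma> 2)" for \<sigma> :: "nat \<Rightarrow> nat"
  have eig: "\<forall>\<sigma>\<in>star_colorings b k.
      (\<Sum>\<tau>\<in>star_colorings b k. glauber_P b k \<sigma> \<tau> * f \<tau>) = real b / real (b + 1) * f \<sigma>"
  proof
    fix \<sigma> assume s: "\<sigma> \<in> star_colorings b k"
    let ?H = "(\<Sum>c\<in>{1..k} - {\<sigma> 0}. h c) / real (card ({1..k} - {\<sigma> 0}))"
    have leaf: "allowed b k \<sigma> 1 = {1..k} - {\<sigma> 0}"
      by (rule allowed_leaf) (use b in auto)
    have "0 < card (allowed b k \<sigma> 1)"
      by (rule card_allowed_pos[OF s]) (use b in simp)
    then have c: "real (card ({1..k} - {\<sigma> 0})) \<noteq> 0"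
      by (simp only: leaf of_nat_eq_0_iff neq0_conv)
    have 1: "resample b k 1 f \<sigma> = ?H - h (\<sigma> 2)"
      unfolding resample_def using b c
      by (subst (1 2) allowed_leaf) (simp_all add: f_def sum_subtractf diff_divide_distrib)
    have 2: "resample b k 2 f \<sigma> = h (\<sigma> 1) - ?H"
      unfolding resample_def using b c
      by (subst (1 2) allowed_leaf) (simp_all add: f_def sum_subtractf diff_divide_distrib)
    have sub: "{1, 2} \<subseteq> {0..b}" using b by auto
    have "(\<Sum>v\<in>{0..b}. resample b k v f \<sigma>) =
        (\<Sum>v\<in>{0..b} - {1, 2}. resample b k v f \<sigma>) + (\<Sum>v\<in>{1, 2}. resample b k v f \<sigma>)"
      by (rule sum.subset_diff[OF sub]) simp
    also have "(\<Sum>v\<in>{0..b} - {1, 2}. resample b k v f \<sigma>) = (\<Sum>v\<in>{0..b} - {1, 2}. f \<sigma>)"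
      by (intro sum.cong refl resample_const s) (auto simp: f_def)
    also have "\<dots> = (real b - 1) * f \<sigma>"
      using b by (simp add: card_Diff_subset sub of_nat_diff)
    also have "(\<Sum>v\<in>{1, 2}. resample b k v f \<sigma>) = f \<sigma>"
      using 1 2 by (simp add: f_def)
    finally show "(\<Sum>\<tau>\<in>star_colorings b k. glauber_P b k \<sigma> \<tau> * f \<tau>) = real b / real (b + 1) * f \<sigma>"
      unfolding glauber_apply[OF s] by (simp add: algebra_simps)
  qed
  moreover have "real b / real (b + 1) \<noteq> 1" by simp
  ultimately have "(\<Sum>\<sigma>\<in>star_colorings b k. f \<sigma>) = 0"
    by (rule eigenvalue_sum_zero)
  moreover have "\<exists>\<sigma>\<in>star_colorings b k. f \<sigma> \<noteq> 0"
  proof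
    let ?\<sigma> = "\<lambda>i. if i > b then undefined else if i = 0 then 2 else if i = 1 then 1 else (3::nat)"
    show "?\<sigma> \<in> star_colorings b k"
      using b k by (auto simp: star_colorings_iff PiE_iff extensional_def)
    show "f ?\<sigma> \<noteq> 0" using b by (simp add: f_def h_def)
  qed
  ultimately show ?thesis
    using eig unfolding nontrivial_eigenvalue_def by (intro exI[of _ f] conjI)
qed

text \<open>The contraction bounds the square of \<open>l\<close>, so negative eigenvalues need no
  separate argument; the square root halves the gap.\<close>

lemma nontrivial_eigenvalue_le:
  assumes few: "(k - 2) * (k - 3) ^ b \<le> (k - 2) ^ b" and k: "k \<ge> 3"
    and l: "nontrivial_eigenvalue b k l"
  shows "\<bar>l\<bar> \<le> 1 - gap b k / 2"
proof -
  obtain f where nz: "\<exists>\<sigma>\<in>star_colorings b k. f \<sigma> \<noteq> 0"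
    and mean: "(\<Sum>\<sigma>\<in>star_colorings b k. f \<sigma>) = 0"
    and eig: "\<forall>\<sigma>\<in>star_colorings b k. (\<Sum>\<tau>\<in>star_colorings b k. glauber_P b k \<sigma> \<tau> * f \<tau>) = l * f \<sigma>"
    using l unfolding nontrivial_eigenvalue_def by (elim exE conjE)
  have "l\<^sup>2 * (\<Sum>\<sigma>\<in>star_colorings b k. (f \<sigma>)\<^sup>2) \<le> (1 - gap b k) * (\<Sum>\<sigma>\<in>star_colorings b k. (f \<sigma>)\<^sup>2)"
    using glauber_contract[OF few k mean] eig by (simp add: power_mult_distrib sum_distrib_left)
  moreover obtain \<sigma> where s: "\<sigma> \<in> star_colorings b k" "f \<sigma> \<noteq> 0" using nz by (elim bexE)
  have "0 < (\<Sum>\<sigma>\<in>star_colorings b k. (f \<sigma>)\<^sup>2)"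
    by (rule sum_pos2[OF finite_star_colorings s(1)]) (use s(2) in simp_all)
  ultimately have "l\<^sup>2 \<le> 1 - gap b k" by simp
  also have "\<dots> \<le> (1 - gap b k / 2)\<^sup>2" by (simp add: power2_diff)
  finally have "\<bar>l\<bar>\<^sup>2 \<le> (1 - gap b k / 2)\<^sup>2" by simp
  then show ?thesis using gap_bounds(2)[of b k] by (elim power2_le_imp_le) simp
qed

text \<open>The strict bound on \<open>lambda_star\<close> makes the second claim meaningful, since
  \<open>1 / 0 = 0\<close>.\<close>

lemma relaxation_time_le:
  assumes few: "(k - 2) * (k - 3) ^ b \<le> (k - 2) ^ b" and k: "k \<ge> 3" and b: "b \<ge> 2"
  shows "lambda_star b k < 1" "relaxation_time b k \<le> 2 / gap b k"
proof -
  have "lambda_star b k \<le> 1 - gap b k / 2"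
    unfolding lambda_star_def
  proof (rule cSup_least)
    show "{\<bar>l\<bar> |l. nontrivial_eigenvalue b k l} \<noteq> {}"
      using ex_nontrivial_eigenvalue[OF b k] by blast
  qed (use nontrivial_eigenvalue_le[OF few k] in blast)
  then have *: "gap b k / 2 \<le> 1 - lambda_star b k" by simp
  then show "lambda_star b k < 1" using gap_bounds(1)[of b k] by simp
  have "1 / (1 - lambda_star b k) \<le> 1 / (gap b k / 2)"
    using * gap_bounds(1)[of b k] by (intro divide_left_mono) auto
  then show "relaxation_time b k \<le> 2 / gap b k" by (simp add: relaxation_time_def)
qed

section \<open>Asymptotics in b\<close>

lemma one_plus_power_le_exp:
  fixes x :: real
  assumes "-1 \<le> x"
  shows "(1 + x) ^ n \<le> exp (real n * x)"
  using power_mono[OF exp_ge_add_one_self[of x], of n] assms by (simp add: exp_of_nat_mult)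

text \<open>The exponent is at most \<open>b * k\<close> times the chance that a given vertex was
  never picked, so that chance must be about the inverse square of \<open>b\<close>: hence the
  factor 2.\<close>

lemma stale_power_le:
  assumes k: "2 \<le> k" "k \<le> b" and b: "b \<ge> 2" and t: "2 * real (b + 1) * ln (real b) \<le> real t"
  shows "stale b k t ^ b \<le> exp 1"
proof -
  let ?n = "real (b + 1)"
  have "(1 - 1 / ?n) ^ t \<le> exp (real t * (- (1 / ?n)))"
    using one_plus_power_le_exp[of "- (1 / ?n)" t] by simp
  also have "\<dots> \<le> exp (- (2 * ln (real b)))"
    using t by (simp add: field_simps)
  also have "\<dots> = 1 / (real b)\<^sup>2"
    using b by (simp add: exp_minus exp_double inverse_eq_divide)
  finally have q: "(1 - 1 / ?n) ^ t \<le> 1 / (real b)\<^sup>2" .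
  have "stale b k t ^ b \<le> exp (real b * (real (k - 2) * (1 - 1 / ?n) ^ t))"
    unfolding stale_def by (rule one_plus_power_le_exp) (rule order_trans[of _ 0], simp_all)
  also have "\<dots> \<le> exp (real b * (real b * (1 / (real b)\<^sup>2)))"
    using k q by (intro iffD2[OF exp_le_cancel_iff] mult_left_mono mult_mono) auto
  also have "\<dots> = exp 1"
    using b by (simp add: power2_eq_square)
  finally show ?thesis .
qed

text \<open>The decay must beat \<open>exp 1 * k\<close> by a further \<open>exp 2\<close>, whence
  \<open>3 = 1 + 2\<close>; \<open>ln b\<close> absorbs \<open>k \<le> b\<close>.\<close>

lemma gap_power_le:
  assumes k: "k \<le> b" and b: "b \<ge> 1" and j: "(3 + ln (real b)) / gap b k \<le> real j"
  shows "exp 1 * real k * (1 - gap b k) ^ j \<le> (1 / exp 1)\<^sup>2"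
proof -
  have "(1 - gap b k) ^ j \<le> exp (real j * (- gap b k))"
    using one_plus_power_le_exp[of "- gap b k" j] gap_bounds[of b k] by simp
  also have "\<dots> \<le> exp (- (3 + ln (real b)))"
    using j gap_bounds(1)[of b k] by (simp add: field_simps)
  also have "\<dots> = exp (- 3) / real b"
    using b by (simp add: exp_diff)
  finally have "exp 1 * real k * (1 - gap b k) ^ j \<le> exp 1 * real b * (exp (- 3) / real b)"
    using k gap_bounds(2)[of b k] by (intro mult_mono) auto
  also have "\<dots> = exp (1 + - 3)"
    using b by (simp only: exp_add) simp
  also have "\<dots> = (1 / exp 1)\<^sup>2"
    by (simp add: exp_minus power_divide inverse_eq_divide flip: exp_double)
  finally show ?thesis .
qed

text \<open>The regime \<open>C \<le> 1\<close> enters as \<open>k * ln b \<le> b\<close>: each of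
  the \<open>k - 2\<close> further colours is then free with probability at most
  \<open>1 / b\<close>, and \<open>k - 2 \<le> b\<close>.\<close>

lemma few_colours:
  assumes k: "k \<ge> 3" "k \<le> b" and kb: "real k * ln (real b) \<le> real b"
  shows "(k - 2) * (k - 3) ^ b \<le> (k - 2) ^ b"
proof -
  define a where "a = real (k - 2)"
  have a: "1 \<le> a" "a \<le> real k" using k by (auto simp: a_def)
  have b: "0 < real b" using k by simp
  have a3: "real (k - 3) = a * (1 + - (1 / a))" using k a by (simp add: a_def field_simps)
  have "a * ln (real b) \<le> real k * ln (real b)" using a b k by (intro mult_right_mono) auto
  then have "a * ln (real b) \<le> real b" using kb by simp
  then have *: "ln (real b) \<le> real b / a" using a by (simp add: field_simps)
  have "(1 + - (1 / a)) ^ b \<le> exp (real b * (- (1 / a)))"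
    using a by (intro one_plus_power_le_exp) simp
  also have "\<dots> \<le> exp (- ln (real b))" using * by simp
  also have "\<dots> = 1 / real b" using b by (simp add: exp_minus inverse_eq_divide)
  finally have "a * real (k - 3) ^ b \<le> a * (a ^ b * (1 / real b))"
    unfolding a3 power_mult_distrib using a by (intro mult_left_mono) auto
  also have "\<dots> = a ^ b * (a / real b)" by simp
  also have "\<dots> \<le> a ^ b * 1" using a k b by (intro mult_left_mono) auto
  finally have "real ((k - 2) * (k - 3) ^ b) \<le> real ((k - 2) ^ b)"
    unfolding of_nat_mult of_nat_power a_def by simp
  then show ?thesis by (simp only: of_nat_le_iff)
qed

text \<open>Rounding gives \<open>k - 2 > y b - 3\<close>; the summand 1 in \<open>near\<close>
  absorbs this shift and becomes the factor \<open>exp 1\<close>. With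
  \<open>b + 1 \<le> 2 * b\<close> the 2 in \<open>poincare_const\<close> turns into 4, and
  \<open>k \<ge> y b / 2\<close> turns 12 into 24, then 48.\<close>

lemma inverse_gap_le:
  fixes C :: real
  defines "y \<equiv> \<lambda>b. C * real b / ln (real b)"
  assumes C: "0 < C" "C \<le> 1" and L: "1 \<le> ln (real b)"
    and y: "4 \<le> y b" and k: "y b - 1 < real k"
    and near: "real b / (y b - 3) \<le> ln (real b) / C + 1"
  shows "1 / gap b k \<le> (4 + 48 * exp 1 / C) * (ln (real b) * real b powr (1 / C))"
proof -
  let ?x = "real b" and ?L = "ln (real b)"
  have b: "1 \<le> ?x" using L by (cases "b = 0") auto
  have k4: "k \<ge> 4" using y k by linarith
  have "?x powr 1 \<le> ?x powr (1 / C)" using b C by (intro powr_mono) auto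
  then have p: "?x \<le> ?x powr (1 / C)" using b by simp
  define a where "a = real (k - 2)"
  have a: "y b - 3 < a" using k k4 by (simp add: a_def)
  have a0: "0 < a" using a y by simp
  have "real (k - 1) / a = 1 + 1 / a" using k4 a0 by (simp add: a_def field_simps)
  then have "(real (k - 1) / a) ^ b \<le> exp (?x * (1 / a))"
    using one_plus_power_le_exp[of "1 / a" b] order_trans[of "- 1" 0 "1 / a"] a0 by simp
  also have "\<dots> \<le> exp (?L / C + 1)"
  proof -
    have "?x * (1 / a) \<le> ?x / (y b - 3)" using a y a0 by (simp add: frac_le)
    then show ?thesis using near by simp
  qed
  also have "\<dots> = exp 1 * ?x powr (1 / C)"
    using b by (simp add: exp_add powr_def)
  finally have r: "(real (k - 1) / a) ^ b \<le> exp 1 * ?x powr (1 / C)" .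
  have "12 / real k \<le> 12 / (y b / 2)" using k y by (intro divide_left_mono) auto
  also have "\<dots> = 24 / C * ?L / ?x" using C by (simp add: y_def)
  finally have k': "12 / real k \<le> 24 / C * ?L / ?x" .
  have "poincare_const b k \<le> 2 + 24 / C * ?L / ?x * (exp 1 * ?x powr (1 / C))"
    unfolding poincare_const_def a_def[symmetric]
    using k' r a0 C L b by (intro add_left_mono mult_mono) auto
  then have "1 / gap b k \<le> (2 * ?x) * (2 + 24 / C * ?L / ?x * (exp 1 * ?x powr (1 / C)))"
    unfolding gap_def using b poincare_const_ge[of b k] by (simp del: of_nat_add) (intro mult_mono, auto)
  also have "\<dots> = 4 * ?x + 48 * exp 1 / C * (?L * ?x powr (1 / C))"
    using b C by (simp add: field_simps)
  also have "\<dots> \<le> 4 * (?L * ?x powr (1 / C)) + 48 * exp 1 / C * (?L * ?x powr (1 / C))"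
    using mult_mono[OF L p] b L by simp
  finally show ?thesis by (simp add: algebra_simps)
qed

text \<open>Burn-in costs only order \<open>b * ln b\<close>; the decay phase,
  \<open>3 + ln b\<close> times the inverse gap, dominates. The case \<open>C = 1\<close> is
  included.\<close>

lemma star_bounds:
  fixes C :: real
  assumes C: "0 < C" "C \<le> 1"
  shows "\<exists>b0 > 0. \<exists>c::real. \<forall>b::nat. real b > b0 \<longrightarrow>
           (let k = nat \<lfloor>C * real b / ln (real b)\<rfloor> in
              real (mixing_time b k) \<le> c * real b powr (1 / C) * (ln (real b))\<^sup>2 \<and>
              lambda_star b k < 1 \<and>
              relaxation_time b k \<le> c * real b powr (1 / C) * (ln (real b))\<^sup>2)"
proof -
  define D where "D = 4 + 48 * exp 1 / C"
  have D: "4 \<le> D" using C by (simp add: D_def)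
  have "\<forall>\<^sub>F x::real in at_top. 1 \<le> ln x" by real_asymp
  moreover have "\<forall>\<^sub>F x in at_top. 4 \<le> C * x / ln x" using C by real_asymp
  moreover have "\<forall>\<^sub>F x in at_top. x / (C * x / ln x - 3) \<le> ln x / C + 1"
    using C by real_asymp
  ultimately have "\<forall>\<^sub>F x in at_top. 1 \<le> ln x \<and> 4 \<le> C * x / ln x \<and>
      x / (C * x / ln x - 3) \<le> ln x / C + 1"
    by (intro eventually_conj)
  then obtain N where N: "\<And>x. N \<le> x \<Longrightarrow> 1 \<le> ln x \<and> 4 \<le> C * x / ln x \<and>
      x / (C * x / ln x - 3) \<le> ln x / C + 1"
    unfolding eventually_at_top_linorder by blast
  have "let k = nat \<lfloor>C * real b / ln (real b)\<rfloor> in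
              real (mixing_time b k) \<le> (6 + 4 * D) * real b powr (1 / C) * (ln (real b))\<^sup>2 \<and>
              lambda_star b k < 1 \<and>
              relaxation_time b k \<le> (6 + 4 * D) * real b powr (1 / C) * (ln (real b))\<^sup>2"
    if bN: "max N 2 < real b" for b
  proof -
    let ?x = "real b" and ?L = "ln (real b)" and ?p = "real b powr (1 / C)"
    define k where "k = nat \<lfloor>C * real b / ln (real b)\<rfloor>"
    have L: "1 \<le> ?L" and y: "4 \<le> C * ?x / ?L"
      and near: "?x / (C * ?x / ?L - 3) \<le> ?L / C + 1"
      using N[of ?x] bN by auto
    have b: "2 \<le> b" "2 \<le> ?x" using bN by auto
    have k_gt: "C * ?x / ?L - 1 < real k" and k_le: "real k \<le> C * ?x / ?L"
      using y unfolding k_def by linarith+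
    have k3: "k \<ge> 3" using k_gt y by linarith
    have Cx: "C * ?x \<le> ?x" using C b by simp
    have kL: "real k * ?L \<le> ?x" using k_le L Cx by (simp add: field_simps)
    have "real k * 1 \<le> real k * ?L" using L by (intro mult_left_mono) auto
    then have kb: "k \<le> b" using kL by linarith
    have few: "(k - 2) * (k - 3) ^ b \<le> (k - 2) ^ b"
      by (rule few_colours[OF k3 kb kL])
    have gap: "1 / gap b k \<le> D * (?L * ?p)"
      unfolding D_def by (rule inverse_gap_le[OF C L y k_gt near])
    have "?x powr 1 \<le> ?p" using b C by (intro powr_mono) auto
    then have p: "?x \<le> ?p" using b by simp
    have L2: "?L * 1 \<le> ?L * ?L" using L by (intro mult_left_mono) auto
    have LLp: "?L * ?p \<le> ?L\<^sup>2 * ?p"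
      using L2 by (intro mult_right_mono) (auto simp: power2_eq_square)
    have xLp: "?x * ?L \<le> ?L\<^sup>2 * ?p"
    proof -
      have "?x * ?L \<le> ?p * ?L" using p L by (intro mult_right_mono) auto
      then show ?thesis using LLp by (simp add: mult.commute)
    qed
    have xle: "?x \<le> ?x * ?L" using b L by simp
    define t where "t = nat \<lceil>2 * real (b + 1) * ?L\<rceil>"
    define j where "j = nat \<lceil>(3 + ?L) / gap b k\<rceil>"
    have "tv_to_uniform b k (t + j) \<sigma> \<le> 1 / (2 * exp 1)"
      if s: "\<sigma> \<in> star_colorings b k" for \<sigma>
    proof (rule tv_le[OF few k3 s])
      show "stale b k t ^ b \<le> exp 1"
        by (rule stale_power_le) (use k3 kb b in \<open>simp_all add: t_def real_nat_ceiling_ge\<close>)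
      show "exp 1 * real k * (1 - gap b k) ^ j \<le> (1 / exp 1)\<^sup>2"
        by (rule gap_power_le) (use kb b in \<open>simp_all add: j_def real_nat_ceiling_ge\<close>)
    qed
    then have "real (mixing_time b k) \<le> real (t + j)"
      using mixing_time_le by (intro of_nat_mono) blast
    also have "\<dots> \<le> (2 * real (b + 1) * ?L + 1) + ((3 + ?L) / gap b k + 1)"
    proof -
      have "0 \<le> 2 * real (b + 1) * ?L" using L by simp
      moreover have "0 \<le> (3 + ?L) / gap b k" using L gap_bounds(1)[of b k] by simp
      ultimately show ?thesis unfolding t_def j_def of_nat_add by linarith
    qed
    also have "\<dots> \<le> 6 * (?L\<^sup>2 * ?p) + 4 * D * (?L\<^sup>2 * ?p)"
    proof -
      have "(3 + ?L) * (1 / gap b k) \<le> (4 * ?L) * (D * (?L * ?p))"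
        using L gap_bounds(1)[of b k] D by (intro mult_mono gap) auto
      then have "(3 + ?L) / gap b k \<le> 4 * D * (?L\<^sup>2 * ?p)"
        by (simp add: power2_eq_square mult_ac)
      moreover have "2 * real (b + 1) * ?L = 2 * (?x * ?L) + 2 * ?L"
        by (simp add: algebra_simps)
      moreover have "2 * ?L \<le> ?x * ?L" using b L by (intro mult_right_mono) auto
      ultimately show ?thesis using xLp xle b by linarith
    qed
    also have "\<dots> = (6 + 4 * D) * ?p * ?L\<^sup>2" by (simp add: algebra_simps)
    finally have mix: "real (mixing_time b k) \<le> (6 + 4 * D) * ?p * ?L\<^sup>2" .
    have "relaxation_time b k \<le> 2 * (1 / gap b k)"
      using relaxation_time_le(2)[OF few k3 b(1)] by simp
    also have "\<dots> \<le> 2 * (D * (?L\<^sup>2 * ?p))"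
      using gap LLp D by (smt (verit) mult_left_mono)
    also have "\<dots> \<le> (6 + 4 * D) * (?L\<^sup>2 * ?p)"
      unfolding mult.assoc[symmetric, of 2] mult.assoc[symmetric, of _ "?L\<^sup>2"]
      using D by (intro mult_right_mono) auto
    finally have rel: "relaxation_time b k \<le> (6 + 4 * D) * ?p * ?L\<^sup>2"
      by (simp add: mult_ac)
    show ?thesis
      unfolding Let_def k_def[symmetric] using mix rel relaxation_time_le(1)[OF few k3 b(1)] by blast
  qed
  then show ?thesis
    by - (rule exI[of _ "max N 2"], rule conjI, simp, rule exI[of _ "6 + 4 * D"], blast)
qed

theorem theorem4:
  shows "(\<forall>C::real. 0 < C \<and> C < 1 \<longrightarrow>
            (\<exists>b0 > 0. \<exists>c::real. \<forall>b::nat. real b > b0 \<longrightarrow>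
               (let k = nat \<lfloor>C * real b / ln (real b)\<rfloor> in
                  real (mixing_time b k) \<le> c * real b powr (1 / C) * (ln (real b))\<^sup>2 \<and>
                  lambda_star b k < 1 \<and>
                  relaxation_time b k \<le> c * real b powr (1 / C) * (ln (real b))\<^sup>2)))
       \<and> (\<exists>b0 > 0. \<exists>c::real. \<forall>b::nat. real b > b0 \<longrightarrow>
               (let k = nat \<lfloor>real b / ln (real b)\<rfloor> in
                  real (mixing_time b k) \<le> c * real b * (ln (real b)) ^ 4 \<and>
                  lambda_star b k < 1 \<and>
                  relaxation_time b k \<le> c * real b * (ln (real b)) ^ 4))"
proof (intro conjI allI impI)
  fix C :: real assume "0 < C \<and> C < 1"
  then show "\<exists>b0 > 0. \<exists>c::real. \<forall>b::nat. real b > b0 \<longrightarrow>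
               (let k = nat \<lfloor>C * real b / ln (real b)\<rfloor> in
                  real (mixing_time b k) \<le> c * real b powr (1 / C) * (ln (real b))\<^sup>2 \<and>
                  lambda_star b k < 1 \<and>
                  relaxation_time b k \<le> c * real b powr (1 / C) * (ln (real b))\<^sup>2)"
    by (intro star_bounds) auto
next
  obtain b0 c :: real where "b0 > 0" and bd: "\<And>b::nat. real b > b0 \<Longrightarrow>
      real (mixing_time b (nat \<lfloor>real b / ln (real b)\<rfloor>)) \<le> c * real b * (ln (real b))\<^sup>2 \<and>
      lambda_star b (nat \<lfloor>real b / ln (real b)\<rfloor>) < 1 \<and>
      relaxation_time b (nat \<lfloor>real b / ln (real b)\<rfloor>) \<le> c * real b * (ln (real b))\<^sup>2"
    using star_bounds[of 1] by (auto simp: Let_def)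
  \<comment> \<open>The sign of \<open>c\<close> is unknown, so its absolute value is taken before
    the exponent is raised from 2 to 4.\<close>
  have up: "c * real b * (ln (real b))\<^sup>2 \<le> \<bar>c\<bar> * real b * (ln (real b)) ^ 4" if "exp 1 < real b" for b :: nat
  proof -
    have "0 < real b" using that exp_gt_zero[of "1::real"] by linarith
    then have "1 \<le> ln (real b)" using that by (simp add: ln_ge_iff)
    then have "(ln (real b))\<^sup>2 \<le> (ln (real b)) ^ 4" by (intro power_increasing) auto
    then show ?thesis by (intro mult_mono) auto
  qed
  have "let k = nat \<lfloor>real b / ln (real b)\<rfloor> in
          real (mixing_time b k) \<le> \<bar>c\<bar> * real b * (ln (real b)) ^ 4 \<and>
          lambda_star b k < 1 \<and>
          relaxation_time b k \<le> \<bar>c\<bar> * real b * (ln (real b)) ^ 4"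
    if "max b0 (exp 1) < real b" for b :: nat
  proof -
    have "b0 < real b" "exp 1 < real b" using that by auto
    from bd[OF this(1)] up[OF this(2)] show ?thesis
      unfolding Let_def by (blast intro: order_trans)
  qed
  moreover have "max b0 (exp 1) > 0" using \<open>b0 > 0\<close> by simp
  ultimately show "\<exists>b0 > 0. \<exists>c::real. \<forall>b::nat. real b > b0 \<longrightarrow>
               (let k = nat \<lfloor>real b / ln (real b)\<rfloor> in
                  real (mixing_time b k) \<le> c * real b * (ln (real b)) ^ 4 \<and>
                  lambda_star b k < 1 \<and>
                  relaxation_time b k \<le> c * real b * (ln (real b)) ^ 4)"
    by blast
qed

end
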